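(* Let $\mathcal U$ be a variety with a difference term, $(Q,B^{\tau})$ central datum in $\mathcal U$, and $\pi:A\to Q$ an extension in $\mathcal U$ realizing $(Q,B^\tau)$ and represented by $[T]\in H^{2}_{\mathcal U}(Q,B^{\tau})$. Let $E^{\tau}\in\mathcal U$ be a kernel algebra and let $\delta_T:\mathrm{Hom}(B^{\tau},E^{\tau})\to H^{2}_{\mathcal U}(Q,E^{\tau})$ be the associated transgression. (1) If $\delta_T$ is surjective, then $\pi$ has the $\rho$-lifting property for every extension $\rho:C\to P$ in $\mathcal U$ realizing central datum $(P,E^{\tau})$. (2) Assume $F_{\mathcal U}(X)/\theta\cong Q$ is a free presentation in $\mathcal U$ such that $F_{\mathcal U}(X)/[\theta,1]$ has an idempotent element. If $\pi$ has the $\rho$-lifting property for some $\rho:C\to Q$ which is $(Q,E^{\tau})$-representative, then $\delta_T$ is surjective. (3) Assume $F_{\mathcal U}(X)/\theta\cong Q$ is a free presentation in $\mathcal U$ such that $F_{\mathcal U}(X)/[\theta,1]$ has an idempotent element. If $\pi$ has the $\mathcal U$-central lifting property for $Q$, then every transgression $\delta_T$ is surjective (i.e. for every kernel algebra $E^{\tau}\in\mathcal U$, $\delta_T:\mathrm{Hom}(B^{\tau},E^{\tau})\to H^{2}_{\mathcal U}(Q,E^{\tau})$ is surjective).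
   Context: Conventions. Algebras are universal algebras in a signature $\tau$; $[\alpha,\beta]$ is the term-condition commutator of congruences; $0,1$ are the least and greatest congruences. A variety $\mathcal U$ has a difference term if there is a ternary term $m$ with $m(x,x,y)=y$ in $\mathcal U$ and $(x,m(x,y,y))\in[\alpha,\alpha]$ whenever $A\in\mathcal U$ and $(x,y)\in\alpha\in\mathrm{Con}\,A$; it is assumed throughout that $m$ is a fundamental operation symbol of $\tau$. An extension is a surjective homomorphism; it is central if its kernel $\alpha$ satisfies $[\alpha,1]=0$. An element $u$ is idempotent if $f(u,\ldots,u)=u$ for all $f\in\tau$. A free presentation of $Q$ in $\mathcal U$ is $F_{\mathcal U}(X)/\theta\cong Q$ with $F_{\mathcal U}(X)$ free in $\mathcal U$ on $X$ and $\theta$ a congruence. Kernel algebras and central datum. A kernel algebra $B^{\tau}$ is a $\tau$-algebra on the universe of a unital module $B$ over a ring $R$ with $1$ in which each $f\in\tau$ is a module term $f^{B}(x_1,\ldots,x_n)=r_1x_1+\cdots+r_nx_n$ $(r_i\in R)$ and $m^{B}(x,y,z)=x-y+z$. Central datum $(Q,B^{\tau})$ in $\mathcal U$ is a kernel algebra $B^{\tau}\in\mathcal U$ and an algebra $Q\in\mathcal U$. Cocycles. A 2-cocycle for $(Q,B^{\tau})$ is a family $T=\{T_f:Q^{\mathrm{ar} f}\to B\}_{f\in\tau}$. The algebra $B^{\tau}\otimes^{T}Q$ has universe $B\times Q$ and operations $F_f((b_1,q_1),\ldots,(b_n,q_n))=(f^{B}(\vec b)+T_f(\vec q),f^{Q}(\vec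 q))$; $p_2$ is its second projection to $Q$. For a term $t$ define $t^{\partial,T}$ by $x^{\partial,T}=0$ for a variable and $f(t_1,\ldots,t_n)^{\partial,T}=f^{B}(t_1^{\partial,T},\ldots,t_n^{\partial,T})+T_f(t_1^{Q},\ldots,t_n^{Q})$. $T$ is $\mathcal U$-compatible if $t^{\partial,T}=g^{\partial,T}$ under all evaluations in $Q$ for every identity $t=g$ of $\mathcal U$. A 2-coboundary is a family $G_f(\vec x)=f^{B}(h(\vec x))-h(f^{Q}(\vec x))$ for some function $h:Q\to B$. Under pointwise addition, $H^{2}_{\mathcal U}(Q,B^{\tau})$ is the group of $\mathcal U$-compatible 2-cocycles modulo 2-coboundaries. A (central) extension $\pi:A\to Q$, $A\in\mathcal U$, realizes $(Q,B^{\tau})$ and is represented by $[T]$ if there is an isomorphism $\psi:A\to B^{\tau}\otimes^{T}Q$ with $p_2\circ\psi=\pi$, $T$ being $\mathcal U$-compatible. $\mathrm{Hom}(B^{\tau},E^{\tau})$ is the abelian group of $\tau$-homomorphisms preserving $0$. Transgression: $\delta_T(\phi)=[\phi\circ T]$. Lifting. For extensions $\pi:A\to Q$ and $\rho:C\to P$, $\pi$ has the $\rho$-lifting property if for every homomorphism $\gamma:Q\to P$ there is a homomorphism $\bar\gamma:A\to C$ with $\gamma\circ\pi=\rho\circ\bar\gamma$. $\pi$ has the $\mathcal U$-central lifting property for $Q$ (also called the $\mathcal U$-lifting property) if it has the $\rho$-lifting property for all central extensions $\rho:C\to P$ with $C\in\mathcal U$. Representative. An extension $\rho:C\to P$ in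 $\mathcal U$ realizing $(P,E^{\tau})$ and represented by $[S]\in H^{2}_{\mathcal U}(P,E^{\tau})$ is $(Q,E^{\tau})$-representative if for every $[R]\in H^{2}_{\mathcal U}(Q,E^{\tau})$ there is a homomorphism $\phi:Q\to P$ with $[R]=[S\circ\phi]$, where $(S\circ\phi)_f(\vec q)=S_f(\phi(q_1),\ldots,\phi(q_n))$. *)

theory Defs
  imports "HOL-Algebra.Coset" "HOL-Algebra.Module"
begin

(*
  Universe convention.  HOL formulas cannot quantify over types, so the class quantifiers
  "every algebra in U" range over all algebras whose carrier is a subset of one arbitrary type 'u,
  which stands for a set-theoretic universe.  A proposition for every adequate 'u (see
  adequate_universe) covers algebras of every size.
*)

section \<open>Signatures, terms, algebras\<close>

text \<open>
  The operation symbols are all the elements of the type \<open>'f\<close>. The distinguished symbol \<open>dsym\<close> is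
  the operation symbol $m$ that plays the role of the difference term.
\<close>

record 'f signature =
  arity :: "'f \<Rightarrow> nat"
  dsym :: 'f

datatype ('f, 'x) trm = Var 'x | Fun 'f "('f, 'x) trm list"

fun wf_trm :: "('f, 'z) signature_scheme \<Rightarrow> ('f, 'x) trm \<Rightarrow> bool" where
  "wf_trm \<tau> (Var x) \<longleftrightarrow> True"
| "wf_trm \<tau> (Fun f ts) \<longleftrightarrow> length ts = arity \<tau> f \<and> (\<forall>t\<in>set ts. wf_trm \<tau> t)"

record ('f, 'a) alg = "'a partial_object" +
  oper :: "'f \<Rightarrow> 'a list \<Rightarrow> 'a"

definition tuples :: "nat \<Rightarrow> 'a set \<Rightarrow> 'a list set" where
  "tuples n S = {xs. length xs = n \<and> set xs \<subseteq> S}"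

text \<open>Values of operations outside the carrier, or on lists of the wrong length, are irrelevant.\<close>

definition universal_algebra :: "('f, 'z) signature_scheme \<Rightarrow> ('f, 'a) alg \<Rightarrow> bool" where
  "universal_algebra \<tau> A \<longleftrightarrow> carrier A \<noteq> {} \<and>
     (\<forall>f. \<forall>xs\<in>tuples (arity \<tau> f) (carrier A). oper A f xs \<in> carrier A)"

fun eval :: "('f, 'a) alg \<Rightarrow> ('x \<Rightarrow> 'a) \<Rightarrow> ('f, 'x) trm \<Rightarrow> 'a" where
  "eval A v (Var x) = v x"
| "eval A v (Fun f ts) = oper A f (map (eval A v) ts)"

definition satisfies :: "('f, 'a) alg \<Rightarrow> ('f, nat) trm \<Rightarrow> ('f, nat) trm \<Rightarrow> bool" where
  "satisfies A t g \<longleftrightarrow> (\<forall>v. (\<forall>i. v i \<in> carrier A) \<longrightarrow> eval A v t = eval A v g)"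

definition alg_hom ::
    "('f, 'z) signature_scheme \<Rightarrow> ('f, 'a) alg \<Rightarrow> ('f, 'b) alg \<Rightarrow> ('a \<Rightarrow> 'b) set" where
  "alg_hom \<tau> A C = {h \<in> carrier A \<rightarrow> carrier C.
     \<forall>f. \<forall>xs\<in>tuples (arity \<tau> f) (carrier A). h (oper A f xs) = oper C f (map h xs)}"

definition alg_iso ::
    "('f, 'z) signature_scheme \<Rightarrow> ('f, 'a) alg \<Rightarrow> ('f, 'b) alg \<Rightarrow> ('a \<Rightarrow> 'b) set" where
  "alg_iso \<tau> A C = {h \<in> alg_hom \<tau> A C. bij_betw h (carrier A) (carrier C)}"

definition idempotent_elem ::
    "('f, 'z) signature_scheme \<Rightarrow> ('f, 'a) alg \<Rightarrow> 'a \<Rightarrow> bool" where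
  "idempotent_elem \<tau> A u \<longleftrightarrow>
     u \<in> carrier A \<and> (\<forall>f. oper A f (replicate (arity \<tau> f) u) = u)"


section \<open>Congruences and the term-condition commutator\<close>

definition congruences :: "('f, 'z) signature_scheme \<Rightarrow> ('f, 'a) alg \<Rightarrow> ('a \<times> 'a) set set" where
  "congruences \<tau> A = {\<theta>. equiv (carrier A) \<theta> \<and>
     (\<forall>f. \<forall>xs\<in>tuples (arity \<tau> f) (carrier A). \<forall>ys\<in>tuples (arity \<tau> f) (carrier A).
        list_all2 (\<lambda>x y. (x, y) \<in> \<theta>) xs ys \<longrightarrow> (oper A f xs, oper A f ys) \<in> \<theta>)}"

definition zero_cong :: "('f, 'a) alg \<Rightarrow> ('a \<times> 'a) set" where
  "zero_cong A = Id_on (carrier A)"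

definition one_cong :: "('f, 'a) alg \<Rightarrow> ('a \<times> 'a) set" where
  "one_cong A = carrier A \<times> carrier A"

definition kernel_cong :: "('f, 'a) alg \<Rightarrow> ('a \<Rightarrow> 'b) \<Rightarrow> ('a \<times> 'a) set" where
  "kernel_cong A \<pi> = {(x, y). x \<in> carrier A \<and> y \<in> carrier A \<and> \<pi> x = \<pi> y}"

text \<open>
  \<open>centralizes \<tau> A \<alpha> \<beta> \<delta>\<close> is the term condition $C(\alpha,\beta;\delta)$. The two blocks of variables of a
  term are \<open>Inl i\<close> and \<open>Inr j\<close>; only finitely many of them occur in a given term, so
  infinite assignments amount to finite tuples.
\<close>

definition centralizes ::
    "('f, 'z) signature_scheme \<Rightarrow> ('f, 'a) alg \<Rightarrow> ('a \<times> 'a) set \<Rightarrow> ('a \<times> 'a) set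
      \<Rightarrow> ('a \<times> 'a) set \<Rightarrow> bool" where
  "centralizes \<tau> A \<alpha> \<beta> \<delta> \<longleftrightarrow>
     (\<forall>t :: ('f, nat + nat) trm. \<forall>a b c d. wf_trm \<tau> t \<longrightarrow>
        (\<forall>i. (a i, b i) \<in> \<alpha>) \<longrightarrow> (\<forall>j. (c j, d j) \<in> \<beta>) \<longrightarrow>
        (eval A (case_sum a c) t, eval A (case_sum a d) t) \<in> \<delta> \<longrightarrow>
        (eval A (case_sum b c) t, eval A (case_sum b d) t) \<in> \<delta>)"

definition commutator ::
    "('f, 'z) signature_scheme \<Rightarrow> ('f, 'a) alg \<Rightarrow> ('a \<times> 'a) set \<Rightarrow> ('a \<times> 'a) set
      \<Rightarrow> ('a \<times> 'a) set" where
  "commutator \<tau> A \<alpha> \<beta> = \<Inter> {\<delta> \<in> congruences \<tau> A. centralizes \<tau> A \<alpha> \<beta> \<delta>}"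

text \<open>\<open>listset Xs\<close> is the set of all lists of representatives of the list \<open>Xs\<close> of classes.\<close>

definition quotient_alg :: "('f, 'a) alg \<Rightarrow> ('a \<times> 'a) set \<Rightarrow> ('f, 'a set) alg" where
  "quotient_alg A \<theta> =
     \<lparr>carrier = carrier A // \<theta>, oper = \<lambda>f Xs. \<Union>xs\<in>listset Xs. \<theta> `` {oper A f xs}\<rparr>"


section \<open>Varieties\<close>

text \<open>A variety is given by a set of defining identities in countably many variables.\<close>

record 'f variety = "'f signature" +
  axs :: "(('f, nat) trm \<times> ('f, nat) trm) set"

definition wf_variety :: "'f variety \<Rightarrow> bool" where
  "wf_variety U \<longleftrightarrow> (\<forall>(t, g)\<in>axs U. wf_trm U t \<and> wf_trm U g)"

definition in_variety :: "'f variety \<Rightarrow> ('f, 'a) alg \<Rightarrow> bool" where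
  "in_variety U A \<longleftrightarrow> universal_algebra U A \<and> (\<forall>(t, g)\<in>axs U. satisfies A t g)"

text \<open>
  The size conditions guarantee that, up to isomorphism, \<open>'u\<close> contains the free algebra of countable
  rank, so that validity in all members of the variety carried by \<open>'u\<close> is validity in the variety,
  and that \<open>'u\<close> is closed under binary products.
\<close>

definition adequate_universe :: "'f itself \<Rightarrow> 'u itself \<Rightarrow> bool" where
  "adequate_universe _ _ \<longleftrightarrow> infinite (UNIV :: 'u set) \<and> (\<exists>e :: 'f \<Rightarrow> 'u. inj e)"

definition identity_of ::
    "'u itself \<Rightarrow> 'f variety \<Rightarrow> ('f, nat) trm \<Rightarrow> ('f, nat) trm \<Rightarrow> bool" where
  "identity_of _ U t g \<longleftrightarrow> wf_trm U t \<and> wf_trm U g \<and>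
     (\<forall>A :: ('f, 'u) alg. in_variety U A \<longrightarrow> satisfies A t g)"

definition has_difference_term :: "'u itself \<Rightarrow> 'f variety \<Rightarrow> bool" where
  "has_difference_term _ U \<longleftrightarrow> arity U (dsym U) = 3 \<and>
     (\<forall>A :: ('f, 'u) alg. in_variety U A \<longrightarrow>
        (\<forall>x\<in>carrier A. \<forall>y\<in>carrier A. oper A (dsym U) [x, x, y] = y) \<and>
        (\<forall>\<alpha>\<in>congruences U A. \<forall>(x, y)\<in>\<alpha>.
           (x, oper A (dsym U) [x, y, y]) \<in> commutator U A \<alpha> \<alpha>))"

text \<open>
  \<open>F\<close> is free in \<open>U\<close> on \<open>X\<close>, by the universal property. The generators are given by a map \<open>\<iota>\<close>, which is
  not injective when \<open>U\<close> is trivial and \<open>X\<close> has several elements.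
\<close>

definition free_in ::
    "'f variety \<Rightarrow> ('f, 'u) alg \<Rightarrow> 'x set \<Rightarrow> ('x \<Rightarrow> 'u) \<Rightarrow> bool" where
  "free_in U F X \<iota> \<longleftrightarrow> in_variety U F \<and> \<iota> \<in> X \<rightarrow> carrier F \<and>
     (\<forall>A :: ('f, 'u) alg. in_variety U A \<longrightarrow> (\<forall>h\<in>X \<rightarrow> carrier A.
        (\<exists>k\<in>alg_hom U F A. \<forall>x\<in>X. k (\<iota> x) = h x) \<and>
        (\<forall>k\<in>alg_hom U F A. \<forall>k'\<in>alg_hom U F A.
           (\<forall>x\<in>X. k (\<iota> x) = h x \<and> k' (\<iota> x) = h x) \<longrightarrow> (\<forall>a\<in>carrier F. k a = k' a))))"

definition free_presentation ::
    "'f variety \<Rightarrow> ('f, 'u) alg \<Rightarrow> 'x set \<Rightarrow> ('x \<Rightarrow> 'u) \<Rightarrow> ('u \<times> 'u) set \<Rightarrow> ('f, 'u) alg \<Rightarrow> bool" where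
  "free_presentation U F X \<iota> \<theta> Q \<longleftrightarrow> free_in U F X \<iota> \<and> \<theta> \<in> congruences U F \<and>
     alg_iso U (quotient_alg F \<theta>) Q \<noteq> {}"


section \<open>Extensions and lifting\<close>

definition extension ::
    "('f, 'z) signature_scheme \<Rightarrow> ('f, 'a) alg \<Rightarrow> ('a \<Rightarrow> 'b) \<Rightarrow> ('f, 'b) alg \<Rightarrow> bool" where
  "extension \<tau> A \<pi> Q \<longleftrightarrow> universal_algebra \<tau> A \<and> universal_algebra \<tau> Q \<and> \<pi> \<in> alg_hom \<tau> A Q \<and>
     \<pi> ` carrier A = carrier Q"

definition central_extension ::
    "('f, 'z) signature_scheme \<Rightarrow> ('f, 'a) alg \<Rightarrow> ('a \<Rightarrow> 'b) \<Rightarrow> ('f, 'b) alg \<Rightarrow> bool" where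
  "central_extension \<tau> A \<pi> Q \<longleftrightarrow> extension \<tau> A \<pi> Q \<and>
     commutator \<tau> A (kernel_cong A \<pi>) (one_cong A) = zero_cong A"

definition lifting_property ::
    "('f, 'z) signature_scheme \<Rightarrow> ('f, 'a) alg \<Rightarrow> ('a \<Rightarrow> 'q) \<Rightarrow> ('f, 'q) alg
      \<Rightarrow> ('f, 'c) alg \<Rightarrow> ('c \<Rightarrow> 'p) \<Rightarrow> ('f, 'p) alg \<Rightarrow> bool" where
  "lifting_property \<tau> A \<pi> Q C \<rho> P \<longleftrightarrow>
     (\<forall>\<gamma>\<in>alg_hom \<tau> Q P. \<exists>\<gamma>'\<in>alg_hom \<tau> A C. \<forall>a\<in>carrier A. \<gamma> (\<pi> a) = \<rho> (\<gamma>' a))"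

definition central_lifting_property ::
    "'f variety \<Rightarrow> ('f, 'u) alg \<Rightarrow> ('u \<Rightarrow> 'u) \<Rightarrow> ('f, 'u) alg \<Rightarrow> bool" where
  "central_lifting_property U A \<pi> Q \<longleftrightarrow>
     (\<forall>(C :: ('f, 'u) alg) \<rho> (P :: ('f, 'u) alg).
        in_variety U C \<longrightarrow> central_extension U C \<rho> P \<longrightarrow> lifting_property U A \<pi> Q C \<rho> P)"


section \<open>Kernel algebras and central data\<close>

text \<open>
  Rings are not assumed commutative here, whereas the locale \<open>module\<close> of HOL-Algebra
  requires a commutative ring.
\<close>

locale unital_module = R?: ring R + M?: abelian_group M
  for R :: "('r, 'y) ring_scheme" (structure) and M :: "('r, 'b, 'z) module_scheme" (structure) +
  assumes smult_closed: "\<lbrakk>r \<in> carrier R; x \<in> carrier M\<rbrakk> \<Longrightarrow> r \<odot>\<^bsub>M\<^esub> x \<in> carrier M"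
    and smult_l_distr: "\<lbrakk>r \<in> carrier R; s \<in> carrier R; x \<in> carrier M\<rbrakk> \<Longrightarrow>
      (r \<oplus>\<^bsub>R\<^esub> s) \<odot>\<^bsub>M\<^esub> x = r \<odot>\<^bsub>M\<^esub> x \<oplus>\<^bsub>M\<^esub> s \<odot>\<^bsub>M\<^esub> x"
    and smult_r_distr: "\<lbrakk>r \<in> carrier R; x \<in> carrier M; y \<in> carrier M\<rbrakk> \<Longrightarrow>
      r \<odot>\<^bsub>M\<^esub> (x \<oplus>\<^bsub>M\<^esub> y) = r \<odot>\<^bsub>M\<^esub> x \<oplus>\<^bsub>M\<^esub> r \<odot>\<^bsub>M\<^esub> y"
    and smult_assoc: "\<lbrakk>r \<in> carrier R; s \<in> carrier R; x \<in> carrier M\<rbrakk> \<Longrightarrow>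
      (r \<otimes>\<^bsub>R\<^esub> s) \<odot>\<^bsub>M\<^esub> x = r \<odot>\<^bsub>M\<^esub> (s \<odot>\<^bsub>M\<^esub> x)"
    and smult_one: "x \<in> carrier M \<Longrightarrow> \<one>\<^bsub>R\<^esub> \<odot>\<^bsub>M\<^esub> x = x"

record ('f, 'r, 'b) kernel_alg = "('r, 'b) module" +
  scalars :: "'r ring"
  koper :: "'f \<Rightarrow> 'b list \<Rightarrow> 'b"

definition kalg :: "('f, 'r, 'b) kernel_alg \<Rightarrow> ('f, 'b) alg" where
  "kalg B = \<lparr>carrier = carrier B, oper = koper B\<rparr>"

definition kernel_algebra :: "('f, 'z) signature_scheme \<Rightarrow> ('f, 'r, 'b) kernel_alg \<Rightarrow> bool" where
  "kernel_algebra \<tau> B \<longleftrightarrow> unital_module (scalars B) B \<and>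
     (\<forall>f. \<exists>r. (\<forall>i<arity \<tau> f. r i \<in> carrier (scalars B)) \<and>
        (\<forall>xs\<in>tuples (arity \<tau> f) (carrier B).
           koper B f xs = (\<Oplus>\<^bsub>B\<^esub>i\<in>{..<arity \<tau> f}. r i \<odot>\<^bsub>B\<^esub> (xs ! i)))) \<and>
     (\<forall>x\<in>carrier B. \<forall>y\<in>carrier B. \<forall>z\<in>carrier B.
        koper B (dsym \<tau>) [x, y, z] = (x \<ominus>\<^bsub>B\<^esub> y) \<oplus>\<^bsub>B\<^esub> z)"

definition central_datum :: "'f variety \<Rightarrow> ('f, 'q) alg \<Rightarrow> ('f, 'r, 'b) kernel_alg \<Rightarrow> bool" where
  "central_datum U Q B \<longleftrightarrow> in_variety U Q \<and> kernel_algebra U B \<and> in_variety U (kalg B)"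


section \<open>Second cohomology\<close>

text \<open>
  A family of operations \<open>Q \<rightarrow> B\<close> indexed by the symbols is represented by the unique \<open>T\<close> with
  these values that is \<open>undefined\<close> off the relevant tuples (as in \<open>\<rightarrow>\<^sub>E\<close>), so that equality of
  families is equality of functions.
\<close>

definition cochain ::
    "('f, 'z) signature_scheme \<Rightarrow> ('f, 'q) alg \<Rightarrow> ('f \<Rightarrow> 'q list \<Rightarrow> 'b) \<Rightarrow> 'f \<Rightarrow> 'q list \<Rightarrow> 'b" where
  "cochain \<tau> Q T = (\<lambda>f. restrict (T f) (tuples (arity \<tau> f) (carrier Q)))"

definition two_cocycles ::
    "('f, 'z) signature_scheme \<Rightarrow> ('f, 'q) alg \<Rightarrow> ('f, 'r, 'b) kernel_alg \<Rightarrow> ('f \<Rightarrow> 'q list \<Rightarrow> 'b) set" where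
  "two_cocycles \<tau> Q B = {T. \<forall>f. T f \<in> tuples (arity \<tau> f) (carrier Q) \<rightarrow>\<^sub>E carrier B}"

definition twisted_product ::
    "('f, 'r, 'b) kernel_alg \<Rightarrow> ('f \<Rightarrow> 'q list \<Rightarrow> 'b) \<Rightarrow> ('f, 'q) alg \<Rightarrow> ('f, 'b \<times> 'q) alg" where
  "twisted_product B T Q =
     \<lparr>carrier = carrier B \<times> carrier Q,
      oper = \<lambda>f zs. (koper B f (map fst zs) \<oplus>\<^bsub>B\<^esub> T f (map snd zs), oper Q f (map snd zs))\<rparr>"

text \<open>\<open>partial_eval B Q T v t\<close> is $t^{\partial,T}$ under the evaluation \<open>v\<close> in \<open>Q\<close>.\<close>

fun partial_eval ::
    "('f, 'r, 'b) kernel_alg \<Rightarrow> ('f, 'q) alg \<Rightarrow> ('f \<Rightarrow> 'q list \<Rightarrow> 'b) \<Rightarrow> ('x \<Rightarrow> 'q) \<Rightarrow> ('f, 'x) trm \<Rightarrow> 'b" where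
  "partial_eval B Q T v (Var x) = \<zero>\<^bsub>B\<^esub>"
| "partial_eval B Q T v (Fun f ts) =
     koper B f (map (partial_eval B Q T v) ts) \<oplus>\<^bsub>B\<^esub> T f (map (eval Q v) ts)"

definition compatible ::
    "'f variety \<Rightarrow> ('f, 'u) alg \<Rightarrow> ('f, 'r, 'u) kernel_alg \<Rightarrow> ('f \<Rightarrow> 'u list \<Rightarrow> 'u) \<Rightarrow> bool" where
  "compatible U Q B T \<longleftrightarrow>
     (\<forall>t g. identity_of TYPE('u) U t g \<longrightarrow>
        (\<forall>v. (\<forall>i. v i \<in> carrier Q) \<longrightarrow> partial_eval B Q T v t = partial_eval B Q T v g))"

definition cocycle_group ::
    "'f variety \<Rightarrow> ('f, 'u) alg \<Rightarrow> ('f, 'r, 'u) kernel_alg \<Rightarrow> ('f \<Rightarrow> 'u list \<Rightarrow> 'u) monoid" where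
  "cocycle_group U Q B =
     \<lparr>carrier = {T \<in> two_cocycles U Q B. compatible U Q B T},
      mult = \<lambda>S T. cochain U Q (\<lambda>f xs. S f xs \<oplus>\<^bsub>B\<^esub> T f xs),
      one = cochain U Q (\<lambda>f xs. \<zero>\<^bsub>B\<^esub>)\<rparr>"

definition coboundaries ::
    "('f, 'z) signature_scheme \<Rightarrow> ('f, 'q) alg \<Rightarrow> ('f, 'r, 'b) kernel_alg \<Rightarrow> ('f \<Rightarrow> 'q list \<Rightarrow> 'b) set" where
  "coboundaries \<tau> Q B =
     {cochain \<tau> Q (\<lambda>f xs. koper B f (map h xs) \<ominus>\<^bsub>B\<^esub> h (oper Q f xs)) | h.
        h \<in> carrier Q \<rightarrow> carrier B}"

definition H2 ::
    "'f variety \<Rightarrow> ('f, 'u) alg \<Rightarrow> ('f, 'r, 'u) kernel_alg \<Rightarrow> ('f \<Rightarrow> 'u list \<Rightarrow> 'u) set monoid" where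
  "H2 U Q B = cocycle_group U Q B Mod coboundaries U Q B"

definition cohomology_class ::
    "'f variety \<Rightarrow> ('f, 'u) alg \<Rightarrow> ('f, 'r, 'u) kernel_alg \<Rightarrow> ('f \<Rightarrow> 'u list \<Rightarrow> 'u)
      \<Rightarrow> ('f \<Rightarrow> 'u list \<Rightarrow> 'u) set" where
  "cohomology_class U Q B T = coboundaries U Q B #>\<^bsub>cocycle_group U Q B\<^esub> T"

text \<open>
  The kernel of an extension isomorphic over \<open>Q\<close> to a twisted product is automatically central, so
  centrality is not listed as a separate condition.
\<close>

definition represented_by ::
    "'f variety \<Rightarrow> ('f, 'u) alg \<Rightarrow> ('u \<Rightarrow> 'u) \<Rightarrow> ('f, 'u) alg \<Rightarrow> ('f, 'r, 'u) kernel_alg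
      \<Rightarrow> ('f \<Rightarrow> 'u list \<Rightarrow> 'u) \<Rightarrow> bool" where
  "represented_by U A \<pi> Q B T \<longleftrightarrow>
     central_datum U Q B \<and> in_variety U A \<and> extension U A \<pi> Q \<and>
     T \<in> carrier (cocycle_group U Q B) \<and>
     (\<exists>\<psi>\<in>alg_iso U A (twisted_product B T Q). \<forall>a\<in>carrier A. snd (\<psi> a) = \<pi> a)"

definition realizes ::
    "'f variety \<Rightarrow> ('f, 'u) alg \<Rightarrow> ('u \<Rightarrow> 'u) \<Rightarrow> ('f, 'u) alg \<Rightarrow> ('f, 'r, 'u) kernel_alg \<Rightarrow> bool" where
  "realizes U A \<pi> Q B \<longleftrightarrow> (\<exists>T. represented_by U A \<pi> Q B T)"


section \<open>Transgression and representative extensions\<close>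

definition kernel_Hom ::
    "('f, 'z) signature_scheme \<Rightarrow> ('f, 'r, 'b) kernel_alg \<Rightarrow> ('f, 's, 'e) kernel_alg \<Rightarrow> ('b \<Rightarrow> 'e) monoid" where
  "kernel_Hom \<tau> B E =
     \<lparr>carrier = {\<phi> \<in> alg_hom \<tau> (kalg B) (kalg E) \<inter> extensional (carrier B). \<phi> \<zero>\<^bsub>B\<^esub> = \<zero>\<^bsub>E\<^esub>},
      mult = \<lambda>\<phi> \<chi>. \<lambda>b\<in>carrier B. \<phi> b \<oplus>\<^bsub>E\<^esub> \<chi> b,
      one = \<lambda>b\<in>carrier B. \<zero>\<^bsub>E\<^esub>\<rparr>"

definition transgression ::
    "'f variety \<Rightarrow> ('f, 'u) alg \<Rightarrow> ('f, 's, 'u) kernel_alg \<Rightarrow> ('f \<Rightarrow> 'u list \<Rightarrow> 'u)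
      \<Rightarrow> ('u \<Rightarrow> 'u) \<Rightarrow> ('f \<Rightarrow> 'u list \<Rightarrow> 'u) set" where
  "transgression U Q E T \<phi> = cohomology_class U Q E (cochain U Q (\<lambda>f xs. \<phi> (T f xs)))"

definition transgression_surjective ::
    "'f variety \<Rightarrow> ('f, 'u) alg \<Rightarrow> ('f, 'r, 'u) kernel_alg \<Rightarrow> ('f, 's, 'u) kernel_alg
      \<Rightarrow> ('f \<Rightarrow> 'u list \<Rightarrow> 'u) \<Rightarrow> bool" where
  "transgression_surjective U Q B E T \<longleftrightarrow>
     transgression U Q E T ` carrier (kernel_Hom U B E) = carrier (H2 U Q E)"

definition representative ::
    "'f variety \<Rightarrow> ('f, 'u) alg \<Rightarrow> ('f, 's, 'u) kernel_alg
      \<Rightarrow> ('f, 'u) alg \<Rightarrow> ('u \<Rightarrow> 'u) \<Rightarrow> ('f, 'u) alg \<Rightarrow> ('f \<Rightarrow> 'u list \<Rightarrow> 'u) \<Rightarrow> bool" where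
  "representative U Q E C \<rho> P S \<longleftrightarrow> represented_by U C \<rho> P E S \<and>
     (\<forall>R\<in>carrier (cocycle_group U Q E). \<exists>\<phi>\<in>alg_hom U Q P.
        cohomology_class U Q E R =
        cohomology_class U Q E (cochain U Q (\<lambda>f qs. S f (map \<phi> qs))))"

end

theory Submission
  imports Defs
begin

text \<open>
  Homomorphisms of extensions over \<open>\<gamma> : Q \<rightarrow> P\<close> amount to homomorphisms
  \<open>(b, q) \<mapsto> (k(b, q), \<gamma> q)\<close> of the twisted products \<open>B \<otimes>\<^sup>T Q \<rightarrow> E \<otimes>\<^sup>S P\<close>. If \<open>\<phi> \<circ> T\<close> and \<open>S \<circ> \<gamma>\<close>
  differ by the coboundary of \<open>h\<close>, then \<open>k(b, q) = \<phi> b - h q\<close> defines one. Conversely, the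
  identity \<open>m(x, x, y) = y\<close> forces the cocycles to vanish on \<open>m\<close> at \<open>(q, q, q')\<close>, and applying a
  homomorphism to \<open>m((b, q), (0, q), (b', q')) = (b + b', q')\<close> yields \<open>k(b, q) = \<phi> b + h q\<close>
  with \<open>\<phi>\<close> additive; comparing values on the operations, \<open>\<phi>\<close> is a homomorphism and
  \<open>\<phi> \<circ> T\<close>, \<open>S \<circ> \<gamma>\<close> are cohomologous. For the third part this is applied to the identity of \<open>Q\<close> and the
  central extension \<open>E \<otimes>\<^sup>R Q\<close> for an arbitrary compatible cocycle \<open>R\<close>.
\<close>

section \<open>Homomorphisms and term evaluation\<close>

lemma tuplesD: "xs \<in> tuples n S \<Longrightarrow> length xs = n" "xs \<in> tuples n S \<Longrightarrow> x \<in> set xs \<Longrightarrow> x \<in> S"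
  by (auto simp: tuples_def)

lemma map_in_tuples:
  "length xs = n \<Longrightarrow> (\<And>x. x \<in> set xs \<Longrightarrow> h x \<in> S) \<Longrightarrow> map h xs \<in> tuples n S"
  by (auto simp: tuples_def)

lemma alg_homD:
  assumes "h \<in> alg_hom \<tau> A C"
  shows "x \<in> carrier A \<Longrightarrow> h x \<in> carrier C"
    and "xs \<in> tuples (arity \<tau> f) (carrier A) \<Longrightarrow> h (oper A f xs) = oper C f (map h xs)"
  using assms by (auto simp: alg_hom_def)

lemma universal_algebra_closed:
  "universal_algebra \<tau> A \<Longrightarrow> xs \<in> tuples (arity \<tau> f) (carrier A) \<Longrightarrow> oper A f xs \<in> carrier A"
  by (auto simp: universal_algebra_def)

lemma eval_closed:
  assumes "universal_algebra \<tau> A" "wf_trm \<tau> t" "\<And>i. v i \<in> carrier A"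
  shows "eval A v t \<in> carrier A"
  using assms(2)
proof (induction t)
  case (Fun f ts)
  then show ?case
    by (auto intro!: universal_algebra_closed[OF assms(1)] map_in_tuples)
qed (simp add: assms(3))

lemma eval_hom:
  assumes "universal_algebra \<tau> A" "h \<in> alg_hom \<tau> A C" "wf_trm \<tau> t" "\<And>i. v i \<in> carrier A"
  shows "h (eval A v t) = eval C (\<lambda>i. h (v i)) t"
  using assms(3)
proof (induction t)
  case (Fun f ts)
  have "map (eval A v) ts \<in> tuples (arity \<tau> f) (carrier A)"
    using Fun.prems by (auto intro!: map_in_tuples eval_closed[OF assms(1)] assms(4))
  moreover have "map h (map (eval A v) ts) = map (eval C (\<lambda>i. h (v i))) ts"
    using Fun by auto
  ultimately show ?case
    using alg_homD(2)[OF assms(2)] by (simp del: map_map map_eq_conv)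
qed simp

lemma alg_hom_compose:
  assumes "g \<in> alg_hom \<tau> A C" "h \<in> alg_hom \<tau> C D"
  shows "(\<lambda>x. h (g x)) \<in> alg_hom \<tau> A D"
proof -
  have "map g xs \<in> tuples n (carrier C)" if "xs \<in> tuples n (carrier A)" for n xs
    using that alg_homD(1)[OF assms(1)] by (auto simp: tuples_def)
  then show ?thesis
    using alg_homD[OF assms(1)] alg_homD[OF assms(2)] by (simp add: alg_hom_def comp_def)
qed

lemma alg_iso_inverse:
  assumes "h \<in> alg_iso \<tau> A C" "universal_algebra \<tau> A"
  shows "inv_into (carrier A) h \<in> alg_iso \<tau> C A"
proof -
  let ?k = "inv_into (carrier A) h"
  have hom: "h \<in> alg_hom \<tau> A C" and bij: "bij_betw h (carrier A) (carrier C)"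
    using assms(1) by (auto simp: alg_iso_def)
  have bij': "bij_betw ?k (carrier C) (carrier A)"
    by (rule bij_betw_inv_into[OF bij])
  have "?k (oper C f xs) = oper A f (map ?k xs)" if xs: "xs \<in> tuples (arity \<tau> f) (carrier C)" for f xs
  proof -
    have k: "?k x \<in> carrier A" "h (?k x) = x" if "x \<in> carrier C" for x
      using that bij bij' by (auto simp: bij_betw_def f_inv_into_f)
    have mem: "map ?k xs \<in> tuples (arity \<tau> f) (carrier A)"
      using xs k by (auto simp: tuples_def)
    have "map h (map ?k xs) = xs"
      using xs k by (auto simp: tuples_def intro!: map_idI)
    then have "h (oper A f (map ?k xs)) = oper C f xs"
      using alg_homD(2)[OF hom mem] by simp
    then show ?thesis
      using bij universal_algebra_closed[OF assms(2) mem]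
      by (metis bij_betw_inv_into_left)
  qed
  then show ?thesis
    using bij' by (auto simp: alg_iso_def alg_hom_def bij_betw_def)
qed

text \<open>The inverse isomorphism carries evaluations in \<open>C\<close> to evaluations in
  \<open>A\<close>, where the axioms hold, and its injectivity brings the equality back. Well-formed
  axioms are required because well-formed terms are the ones known to evaluate inside the carrier
  and to commute with homomorphisms.\<close>

lemma in_variety_iso:
  assumes "in_variety U A" "h \<in> alg_iso U A C" "universal_algebra U C" "wf_variety U"
  shows "in_variety U C"
proof -
  have uA: "universal_algebra U A"
    using assms(1) by (simp add: in_variety_def)
  define k where "k = inv_into (carrier A) h"
  have k: "k \<in> alg_hom U C A" "bij_betw k (carrier C) (carrier A)"
    using alg_iso_inverse[OF assms(2) uA] by (auto simp: k_def alg_iso_def)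
  have "satisfies C t g" if "(t, g) \<in> axs U" for t g
    unfolding satisfies_def
  proof (intro allI impI)
    fix v :: "nat \<Rightarrow> 'c" assume v: "\<forall>i. v i \<in> carrier C"
    have wf: "wf_trm U t" "wf_trm U g"
      using assms(4) that by (auto simp: wf_variety_def)
    have "eval A (\<lambda>i. k (v i)) t = eval A (\<lambda>i. k (v i)) g"
      using assms(1) that v alg_homD(1)[OF k(1)] by (auto simp: in_variety_def satisfies_def)
    then have "k (eval C v t) = k (eval C v g)"
      using eval_hom[OF assms(3) k(1) wf(1), of v] eval_hom[OF assms(3) k(1) wf(2), of v] v by simp
    then show "eval C v t = eval C v g"
      using k(2) eval_closed[OF assms(3) wf(1), of v] eval_closed[OF assms(3) wf(2), of v] v
      by (auto simp: bij_betw_def inj_on_def)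
  qed
  then show ?thesis
    using assms(3) by (auto simp: in_variety_def)
qed

section \<open>Kernel algebras and cocycles\<close>

lemma kalg_simps [simp]: "carrier (kalg E) = carrier E" "oper (kalg E) = koper E"
  by (simp_all add: kalg_def)

lemma compatibleI:
  fixes U :: "'f variety" and Q :: "('f, 'u) alg"
  assumes "\<And>t g v. \<lbrakk>identity_of TYPE('u) U t g; wf_trm U t; wf_trm U g; \<And>i. v i \<in> carrier Q\<rbrakk> \<Longrightarrow>
    partial_eval E Q T v t = partial_eval E Q T v g"
  shows "compatible U Q E T"
  using assms by (auto simp: compatible_def identity_of_def)

lemma compatibleD:
  fixes U :: "'f variety" and Q :: "('f, 'u) alg"
  assumes "compatible U Q E T" "identity_of TYPE('u) U t g" "\<And>i. v i \<in> carrier Q"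
  shows "partial_eval E Q T v t = partial_eval E Q T v g"
  using assms by (simp add: compatible_def)

text \<open>One base with one coefficient algebra. Comparing two twisted products takes three
  interpretations, for \<open>(Q, B)\<close>, \<open>(Q, E)\<close> and
  \<open>(P, E)\<close>.\<close>

locale central_data =
  fixes U :: "'f variety" and Q :: "('f, 'u) alg" and E :: "('f, 'r, 'u) kernel_alg"
  assumes datum: "central_datum U Q E"

sublocale central_data \<subseteq> abelian_group E
  using datum unital_module.axioms(2) unfolding central_datum_def kernel_algebra_def by blast

context central_data
begin

lemma universal_algebra_base: "universal_algebra U Q"
  and universal_algebra_kalg: "universal_algebra U (kalg E)"
  and kernel_algebra: "kernel_algebra U E"
  using datum by (auto simp: central_datum_def in_variety_def)

text \<open>Tuples are written as \<open>map a xs\<close> over an index list of any type, here and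
  for \<open>koper\<close>, so that lists of terms, of pairs and of elements are covered by the same
  facts.\<close>

lemma base_closed:
  "length xs = arity U f \<Longrightarrow> (\<And>x. x \<in> set xs \<Longrightarrow> a x \<in> carrier Q) \<Longrightarrow>
     oper Q f (map a xs) \<in> carrier Q"
  by (rule universal_algebra_closed[OF universal_algebra_base]) (rule map_in_tuples)

lemma koper_closed:
  assumes "length xs = arity U f" "\<And>x. x \<in> set xs \<Longrightarrow> a x \<in> carrier E"
  shows "koper E f (map a xs) \<in> carrier E"
  using universal_algebra_closed[OF universal_algebra_kalg, of "map a xs" f]
    map_in_tuples[of xs "arity U f" a "carrier E"] assms
  by (simp add: kalg_def)

text \<open>Each operation is a linear combination of its arguments with fixed scalars, so it
  distributes over entrywise sums. The ring action enters the later arguments only through this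
  additivity.\<close>

lemma koper_add:
  assumes len: "length xs = arity U f"
    and a: "\<And>x. x \<in> set xs \<Longrightarrow> a x \<in> carrier E" and b: "\<And>x. x \<in> set xs \<Longrightarrow> b x \<in> carrier E"
  shows "koper E f (map (\<lambda>x. a x \<oplus>\<^bsub>E\<^esub> b x) xs) = koper E f (map a xs) \<oplus>\<^bsub>E\<^esub> koper E f (map b xs)"
proof -
  interpret M: unital_module "scalars E" E
    using kernel_algebra by (simp add: kernel_algebra_def)
  obtain r where r: "\<And>i. i < arity U f \<Longrightarrow> r i \<in> carrier (scalars E)"
    and eq: "\<And>ys. ys \<in> tuples (arity U f) (carrier E) \<Longrightarrow>
      koper E f ys = (\<Oplus>\<^bsub>E\<^esub>i\<in>{..<arity U f}. r i \<odot>\<^bsub>E\<^esub> (ys ! i))"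
    using kernel_algebra unfolding kernel_algebra_def by meson
  have ab: "a (xs ! i) \<in> carrier E" "b (xs ! i) \<in> carrier E" if "i < arity U f" for i
    using that len a b by auto
  have "koper E f (map (\<lambda>x. a x \<oplus>\<^bsub>E\<^esub> b x) xs)
      = (\<Oplus>\<^bsub>E\<^esub>i\<in>{..<arity U f}. r i \<odot>\<^bsub>E\<^esub> (map (\<lambda>x. a x \<oplus>\<^bsub>E\<^esub> b x) xs ! i))"
    by (rule eq) (auto intro!: map_in_tuples len a b)
  also have "\<dots> = (\<Oplus>\<^bsub>E\<^esub>i\<in>{..<arity U f}.
      r i \<odot>\<^bsub>E\<^esub> (map a xs ! i) \<oplus>\<^bsub>E\<^esub> r i \<odot>\<^bsub>E\<^esub> (map b xs ! i))"
    by (rule finsum_cong') (auto simp: len ab r M.smult_r_distr M.smult_closed)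
  also have "\<dots> = (\<Oplus>\<^bsub>E\<^esub>i\<in>{..<arity U f}. r i \<odot>\<^bsub>E\<^esub> (map a xs ! i)) \<oplus>\<^bsub>E\<^esub>
      (\<Oplus>\<^bsub>E\<^esub>i\<in>{..<arity U f}. r i \<odot>\<^bsub>E\<^esub> (map b xs ! i))"
    by (rule finsum_addf) (auto simp: len ab r M.smult_closed)
  also have "\<dots> = koper E f (map a xs) \<oplus>\<^bsub>E\<^esub> koper E f (map b xs)"
    by (simp add: eq map_in_tuples len a b)
  finally show ?thesis .
qed

lemma minus_add_cancel:
  "x \<in> carrier E \<Longrightarrow> y \<in> carrier E \<Longrightarrow> (x \<ominus>\<^bsub>E\<^esub> y) \<oplus>\<^bsub>E\<^esub> y = x"
  by (simp add: a_minus_def a_assoc l_neg)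

lemma eq_minusI:
  "x \<in> carrier E \<Longrightarrow> y \<in> carrier E \<Longrightarrow> z \<in> carrier E \<Longrightarrow> x \<oplus>\<^bsub>E\<^esub> y = z \<Longrightarrow> x = z \<ominus>\<^bsub>E\<^esub> y"
  by (auto simp: a_minus_def a_assoc r_neg)

lemma minus_zero [simp]: "\<ominus>\<^bsub>E\<^esub> \<zero>\<^bsub>E\<^esub> = \<zero>\<^bsub>E\<^esub>"
  using r_neg[of "\<zero>\<^bsub>E\<^esub>"] by simp

lemma minus_telescope:
  "x \<in> carrier E \<Longrightarrow> y \<in> carrier E \<Longrightarrow> z \<in> carrier E \<Longrightarrow>
     (x \<ominus>\<^bsub>E\<^esub> y) \<oplus>\<^bsub>E\<^esub> (y \<ominus>\<^bsub>E\<^esub> z) = x \<ominus>\<^bsub>E\<^esub> z"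
  by (simp add: a_minus_def a_assoc r_neg1)

lemma koper_minus:
  assumes "length xs = arity U f"
    and "\<And>x. x \<in> set xs \<Longrightarrow> a x \<in> carrier E" and "\<And>x. x \<in> set xs \<Longrightarrow> b x \<in> carrier E"
  shows "koper E f (map (\<lambda>x. a x \<ominus>\<^bsub>E\<^esub> b x) xs) = koper E f (map a xs) \<ominus>\<^bsub>E\<^esub> koper E f (map b xs)"
proof (rule eq_minusI)
  have "map (\<lambda>x. (a x \<ominus>\<^bsub>E\<^esub> b x) \<oplus>\<^bsub>E\<^esub> b x) xs = map a xs"
    using assms by (simp add: minus_add_cancel)
  then show "koper E f (map (\<lambda>x. a x \<ominus>\<^bsub>E\<^esub> b x) xs) \<oplus>\<^bsub>E\<^esub> koper E f (map b xs) = koper E f (map a xs)"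
    using koper_add[of xs f "\<lambda>x. a x \<ominus>\<^bsub>E\<^esub> b x" b] assms by (simp del: map_eq_conv)
qed (use assms in \<open>auto intro!: koper_closed\<close>)

text \<open>The zero tuple is its own difference with itself, so by \<open>koper_minus\<close> the
  value equals its own difference with itself.\<close>

lemma koper_zero:
  assumes "length xs = arity U f"
  shows "koper E f (map (\<lambda>x. \<zero>\<^bsub>E\<^esub>) xs) = \<zero>\<^bsub>E\<^esub>"
  using koper_minus[of xs f "\<lambda>x. \<zero>\<^bsub>E\<^esub>" "\<lambda>x. \<zero>\<^bsub>E\<^esub>"] assms koper_closed[of xs f "\<lambda>x. \<zero>\<^bsub>E\<^esub>"]
  by (simp add: a_minus_def r_neg)

lemma koper_dsym:
  "x \<in> carrier E \<Longrightarrow> y \<in> carrier E \<Longrightarrow> z \<in> carrier E \<Longrightarrow>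
     koper E (dsym U) [x, y, z] = (x \<ominus>\<^bsub>E\<^esub> y) \<oplus>\<^bsub>E\<^esub> z"
  using kernel_algebra by (simp add: kernel_algebra_def)

lemma eval_kalg_closed:
  "wf_trm U t \<Longrightarrow> (\<And>i. v i \<in> carrier E) \<Longrightarrow> eval (kalg E) v t \<in> carrier E"
  using eval_closed[OF universal_algebra_kalg, of t v] by simp

text \<open>Additivity passes from operations to terms. This is what later makes the kernel of a
  twisted product central.\<close>

lemma eval_kalg_add:
  assumes "wf_trm U t" and a: "\<And>i. a i \<in> carrier E" and b: "\<And>i. b i \<in> carrier E"
  shows "eval (kalg E) (\<lambda>i. a i \<oplus>\<^bsub>E\<^esub> b i) t = eval (kalg E) a t \<oplus>\<^bsub>E\<^esub> eval (kalg E) b t"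
  using assms(1)
proof (induction t)
  case (Fun f ts)
  have "map (eval (kalg E) (\<lambda>i. a i \<oplus>\<^bsub>E\<^esub> b i)) ts
      = map (\<lambda>t. eval (kalg E) a t \<oplus>\<^bsub>E\<^esub> eval (kalg E) b t) ts"
    using Fun by auto
  then show ?case
    using koper_add[of ts f "eval (kalg E) a" "eval (kalg E) b"] Fun.prems a b
    by (simp add: eval_kalg_closed del: map_eq_conv)
qed simp

section \<open>Cochains and partial evaluation of terms\<close>

lemma cochain_eq_iff:
  "cochain U Q S = cochain U Q T \<longleftrightarrow>
     (\<forall>f. \<forall>xs\<in>tuples (arity U f) (carrier Q). S f xs = T f xs)"
  by (auto simp: cochain_def fun_eq_iff restrict_def)

lemma cochain_two_cocycle: "T \<in> two_cocycles U Q E \<Longrightarrow> cochain U Q T = T"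
  unfolding cochain_def two_cocycles_def
  by (rule ext, rule PiE_restrict[where B = "\<lambda>_. carrier E"]) simp

lemma two_cocycle_closed:
  "T \<in> two_cocycles U Q E \<Longrightarrow> length xs = arity U f \<Longrightarrow> (\<And>x. x \<in> set xs \<Longrightarrow> a x \<in> carrier Q) \<Longrightarrow>
     T f (map a xs) \<in> carrier E"
  using map_in_tuples[of xs "arity U f" a "carrier Q"] by (force simp: two_cocycles_def)

lemma partial_eval_closed:
  assumes "T \<in> two_cocycles U Q E" "wf_trm U t" "\<And>i. v i \<in> carrier Q"
  shows "partial_eval E Q T v t \<in> carrier E"
  using assms(2)
proof (induction t)
  case (Fun f ts)
  then show ?case
    by (auto intro!: a_closed koper_closed two_cocycle_closed[OF assms(1)]
        eval_closed[OF universal_algebra_base] assms(3))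
qed simp

text \<open>A well-formed term feeds only tuples over \<open>Q\<close> of the right length to the
  cochain, so normalizing the values elsewhere is invisible to it.\<close>

lemma partial_eval_cochain:
  assumes "wf_trm U t" "\<And>i. v i \<in> carrier Q"
  shows "partial_eval E Q (cochain U Q T) v t = partial_eval E Q T v t"
  using assms(1)
proof (induction t)
  case (Fun f ts)
  have "map (eval Q v) ts \<in> tuples (arity U f) (carrier Q)"
    using Fun.prems by (auto intro!: map_in_tuples eval_closed[OF universal_algebra_base] assms(2))
  moreover have "map (partial_eval E Q (cochain U Q T) v) ts = map (partial_eval E Q T v) ts"
    using Fun by auto
  ultimately show ?case
    by (simp del: map_eq_conv) (simp add: cochain_def)
qed simp

text \<open>The operations of \<open>E\<close> are additive, so the cocycle enters each partial
  value additively; sums and negatives of compatible cocycles can then be treated without a new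
  induction.\<close>

lemma partial_eval_add:
  assumes "S \<in> two_cocycles U Q E" "T \<in> two_cocycles U Q E" "wf_trm U t" "\<And>i. v i \<in> carrier Q"
  shows "partial_eval E Q (\<lambda>f xs. S f xs \<oplus>\<^bsub>E\<^esub> T f xs) v t
    = partial_eval E Q S v t \<oplus>\<^bsub>E\<^esub> partial_eval E Q T v t"
  using assms(3)
proof (induction t)
  case (Fun f ts)
  have "map (partial_eval E Q (\<lambda>f xs. S f xs \<oplus>\<^bsub>E\<^esub> T f xs) v) ts
      = map (\<lambda>t. partial_eval E Q S v t \<oplus>\<^bsub>E\<^esub> partial_eval E Q T v t) ts"
    using Fun by auto
  moreover have "koper E f (map (\<lambda>t. partial_eval E Q S v t \<oplus>\<^bsub>E\<^esub> partial_eval E Q T v t) ts)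
      = koper E f (map (partial_eval E Q S v) ts) \<oplus>\<^bsub>E\<^esub> koper E f (map (partial_eval E Q T v) ts)"
    using Fun.prems assms by (intro koper_add partial_eval_closed) auto
  moreover have "koper E f (map (partial_eval E Q S v) ts) \<in> carrier E"
      "koper E f (map (partial_eval E Q T v) ts) \<in> carrier E"
    using Fun.prems assms by (auto intro!: koper_closed partial_eval_closed)
  moreover have "S f (map (eval Q v) ts) \<in> carrier E" "T f (map (eval Q v) ts) \<in> carrier E"
    using Fun.prems assms
    by (auto intro!: two_cocycle_closed eval_closed[OF universal_algebra_base])
  ultimately show ?case
    by (simp add: a_ac del: map_eq_conv)
qed simp

text \<open>The sum telescopes: the values of \<open>h\<close> subtracted at the arguments cancel
  against the term \<open>koper E f (map h ..)\<close> at the root. What survives is the difference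
  between applying \<open>h\<close> before and after evaluation.\<close>

lemma partial_eval_coboundary:
  assumes h: "h \<in> carrier Q \<rightarrow> carrier E" and "wf_trm U t" and v: "\<And>i. v i \<in> carrier Q"
  shows "partial_eval E Q (\<lambda>f xs. koper E f (map h xs) \<ominus>\<^bsub>E\<^esub> h (oper Q f xs)) v t
    = eval (kalg E) (\<lambda>i. h (v i)) t \<ominus>\<^bsub>E\<^esub> h (eval Q v t)"
  using assms(2)
proof (induction t)
  case (Var x)
  then show ?case using funcset_mem[OF h v[of x]] by (simp add: a_minus_def r_neg)
next
  case (Fun f ts)
  let ?ev = "eval (kalg E) (\<lambda>i. h (v i))"
  have ev: "?ev t \<in> carrier E" and hq: "h (eval Q v t) \<in> carrier E" if "t \<in> set ts" for t
    using that Fun.prems h v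
    by (auto intro!: eval_kalg_closed funcset_mem[OF h] eval_closed[OF universal_algebra_base])
  have "map (partial_eval E Q (\<lambda>f xs. koper E f (map h xs) \<ominus>\<^bsub>E\<^esub> h (oper Q f xs)) v) ts
      = map (\<lambda>t. ?ev t \<ominus>\<^bsub>E\<^esub> h (eval Q v t)) ts"
    using Fun by auto
  moreover have "koper E f (map (\<lambda>t. ?ev t \<ominus>\<^bsub>E\<^esub> h (eval Q v t)) ts)
      = koper E f (map ?ev ts) \<ominus>\<^bsub>E\<^esub> koper E f (map (\<lambda>t. h (eval Q v t)) ts)"
    using Fun.prems ev hq by (intro koper_minus) auto
  moreover have "koper E f (map ?ev ts) \<in> carrier E" "koper E f (map (\<lambda>t. h (eval Q v t)) ts) \<in> carrier E"
    using Fun.prems ev hq by (auto intro!: koper_closed)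
  moreover have "h (oper Q f (map (eval Q v) ts)) \<in> carrier E"
    using Fun.prems v
    by (auto intro!: funcset_mem[OF h] base_closed eval_closed[OF universal_algebra_base])
  ultimately show ?case
    by (simp add: comp_def minus_telescope del: map_eq_conv)
qed

lemma compatible_cochain: "compatible U Q E (cochain U Q T) \<longleftrightarrow> compatible U Q E T"
  by (auto simp: compatible_def identity_of_def partial_eval_cochain)

lemma cochain_in_two_cocycles:
  "(\<And>f xs. xs \<in> tuples (arity U f) (carrier Q) \<Longrightarrow> T f xs \<in> carrier E) \<Longrightarrow>
     cochain U Q T \<in> two_cocycles U Q E"
  by (auto simp: cochain_def two_cocycles_def)

lemma satisfies_identity:
  "identity_of TYPE('u) U t g \<Longrightarrow> (\<And>i. v i \<in> carrier Q) \<Longrightarrow> eval Q v t = eval Q v g"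
  "identity_of TYPE('u) U t g \<Longrightarrow> (\<And>i. w i \<in> carrier E) \<Longrightarrow> eval (kalg E) w t = eval (kalg E) w g"
  using datum by (auto simp: central_datum_def identity_of_def satisfies_def kalg_def)

section \<open>The group of compatible cocycles and its subgroup of coboundaries\<close>

lemma cocycle_group_add_closed:
  assumes "S \<in> carrier (cocycle_group U Q E)" "T \<in> carrier (cocycle_group U Q E)"
  shows "S \<otimes>\<^bsub>cocycle_group U Q E\<^esub> T \<in> carrier (cocycle_group U Q E)"
proof -
  have ST: "S \<in> two_cocycles U Q E" "T \<in> two_cocycles U Q E" "compatible U Q E S" "compatible U Q E T"
    using assms by (auto simp: cocycle_group_def)
  have "compatible U Q E (\<lambda>f xs. S f xs \<oplus>\<^bsub>E\<^esub> T f xs)"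
    using compatibleD[OF ST(3)] compatibleD[OF ST(4)]
    by (intro compatibleI) (simp add: partial_eval_add[OF ST(1,2)])
  moreover have "cochain U Q (\<lambda>f xs. S f xs \<oplus>\<^bsub>E\<^esub> T f xs) \<in> two_cocycles U Q E"
    using ST by (intro cochain_in_two_cocycles) (force simp: two_cocycles_def)
  ultimately show ?thesis
    by (simp add: cocycle_group_def compatible_cochain)
qed

text \<open>By the telescoped form, compatibility reduces to the identity holding in the kernel
  algebra and in \<open>Q\<close>.\<close>

lemma coboundary_in_cocycle_group:
  assumes "h \<in> carrier Q \<rightarrow> carrier E"
  shows "cochain U Q (\<lambda>f xs. koper E f (map h xs) \<ominus>\<^bsub>E\<^esub> h (oper Q f xs))
    \<in> carrier (cocycle_group U Q E)"
proof -
  have "compatible U Q E (\<lambda>f xs. koper E f (map h xs) \<ominus>\<^bsub>E\<^esub> h (oper Q f xs))"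
  proof (rule compatibleI)
    fix t g and v :: "nat \<Rightarrow> 'u"
    assume id: "identity_of TYPE('u) U t g" and wf: "wf_trm U t" "wf_trm U g"
      and v: "\<And>i. v i \<in> carrier Q"
    then have "eval (kalg E) (\<lambda>i. h (v i)) t = eval (kalg E) (\<lambda>i. h (v i)) g"
      using assms by (intro satisfies_identity(2)) auto
    moreover have "eval Q v t = eval Q v g"
      using id v by (intro satisfies_identity(1)) auto
    ultimately show "partial_eval E Q (\<lambda>f xs. koper E f (map h xs) \<ominus>\<^bsub>E\<^esub> h (oper Q f xs)) v t
        = partial_eval E Q (\<lambda>f xs. koper E f (map h xs) \<ominus>\<^bsub>E\<^esub> h (oper Q f xs)) v g"
      by (simp add: partial_eval_coboundary[OF assms] wf v)
  qed
  moreover have "cochain U Q (\<lambda>f xs. koper E f (map h xs) \<ominus>\<^bsub>E\<^esub> h (oper Q f xs)) \<in> two_cocycles U Q E"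
    by (rule cochain_in_two_cocycles)
      (auto intro!: koper_closed funcset_mem[OF assms] universal_algebra_closed[OF universal_algebra_base]
        dest: tuplesD)
  ultimately show ?thesis
    by (simp add: cocycle_group_def compatible_cochain)
qed


abbreviation coboundary :: "('u \<Rightarrow> 'u) \<Rightarrow> 'f \<Rightarrow> 'u list \<Rightarrow> 'u" where
  "coboundary h \<equiv> cochain U Q (\<lambda>f xs. koper E f (map h xs) \<ominus>\<^bsub>E\<^esub> h (oper Q f xs))"

text \<open>The sum is a separate function \<open>l\<close>, prescribed only on the carrier, so that
  the zero function can be recognised as the sum of a function and its negative.\<close>

lemma coboundary_add:
  assumes h: "h \<in> carrier Q \<rightarrow> carrier E" and k: "k \<in> carrier Q \<rightarrow> carrier E"
    and l: "\<And>q. q \<in> carrier Q \<Longrightarrow> l q = h q \<oplus>\<^bsub>E\<^esub> k q"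
  shows "coboundary h \<otimes>\<^bsub>cocycle_group U Q E\<^esub> coboundary k = coboundary l"
proof -
  have "(koper E f (map h xs) \<ominus>\<^bsub>E\<^esub> h (oper Q f xs)) \<oplus>\<^bsub>E\<^esub> (koper E f (map k xs) \<ominus>\<^bsub>E\<^esub> k (oper Q f xs))
      = koper E f (map l xs) \<ominus>\<^bsub>E\<^esub> l (oper Q f xs)" if xs: "xs \<in> tuples (arity U f) (carrier Q)" for f xs
  proof -
    have hk: "h x \<in> carrier E" "k x \<in> carrier E" if "x \<in> set xs" for x
      using that tuplesD(2)[OF xs] h k by auto
    have "map l xs = map (\<lambda>x. h x \<oplus>\<^bsub>E\<^esub> k x) xs"
      using tuplesD(2)[OF xs] l by auto
    then have "koper E f (map l xs) = koper E f (map h xs) \<oplus>\<^bsub>E\<^esub> koper E f (map k xs)"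
      using koper_add[of xs f h k] tuplesD(1)[OF xs] hk by (simp del: map_eq_conv)
    moreover have "oper Q f xs \<in> carrier Q"
      using universal_algebra_closed[OF universal_algebra_base xs] .
    then have "l (oper Q f xs) = h (oper Q f xs) \<oplus>\<^bsub>E\<^esub> k (oper Q f xs)"
      "h (oper Q f xs) \<in> carrier E" "k (oper Q f xs) \<in> carrier E"
      using l h k by auto
    moreover have "koper E f (map h xs) \<in> carrier E" "koper E f (map k xs) \<in> carrier E"
      using tuplesD(1)[OF xs] hk by (auto intro!: koper_closed)
    ultimately show ?thesis
      by (simp add: a_minus_def minus_add a_ac)
  qed
  then show ?thesis
    by (simp add: cocycle_group_def cochain_eq_iff) (simp add: cochain_def)
qed

lemma coboundary_zero:
  assumes "\<And>q. q \<in> carrier Q \<Longrightarrow> h q = \<zero>\<^bsub>E\<^esub>"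
  shows "coboundary h = \<one>\<^bsub>cocycle_group U Q E\<^esub>"
proof -
  have "koper E f (map h xs) \<ominus>\<^bsub>E\<^esub> h (oper Q f xs) = \<zero>\<^bsub>E\<^esub>"
    if xs: "xs \<in> tuples (arity U f) (carrier Q)" for f xs
  proof -
    have "map h xs = map (\<lambda>x. \<zero>\<^bsub>E\<^esub>) xs"
      using tuplesD(2)[OF xs] assms by auto
    then show ?thesis
      using koper_zero[of xs f] tuplesD(1)[OF xs] universal_algebra_closed[OF universal_algebra_base xs]
      by (simp add: assms a_minus_def r_neg del: map_eq_conv)
  qed
  then show ?thesis
    by (simp add: cocycle_group_def cochain_eq_iff)
qed

lemma cocycle_group_one_closed: "\<one>\<^bsub>cocycle_group U Q E\<^esub> \<in> carrier (cocycle_group U Q E)"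
  using coboundary_in_cocycle_group[of "\<lambda>q. \<zero>\<^bsub>E\<^esub>"] coboundary_zero[of "\<lambda>q. \<zero>\<^bsub>E\<^esub>"] by simp

text \<open>Compatibility of the negative comes from cancellation: the sum with \<open>T\<close> is
  the neutral cocycle, hence compatible, and partial values are additive, so the compatible summand
  \<open>T\<close> can be cancelled.\<close>

lemma cocycle_group_left_inverse:
  assumes "T \<in> carrier (cocycle_group U Q E)"
  shows "\<exists>S\<in>carrier (cocycle_group U Q E). S \<otimes>\<^bsub>cocycle_group U Q E\<^esub> T = \<one>\<^bsub>cocycle_group U Q E\<^esub>"
proof
  have T: "T \<in> two_cocycles U Q E" "compatible U Q E T"
    using assms by (auto simp: cocycle_group_def)
  have T_closed: "T f xs \<in> carrier E" if "xs \<in> tuples (arity U f) (carrier Q)" for f xs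
    using T(1) that by (auto simp: two_cocycles_def)
  define S where "S = cochain U Q (\<lambda>f xs. \<ominus>\<^bsub>E\<^esub> T f xs)"
  have S: "S \<in> two_cocycles U Q E"
    unfolding S_def by (rule cochain_in_two_cocycles) (simp add: T_closed)
  have inv: "S \<otimes>\<^bsub>cocycle_group U Q E\<^esub> T = \<one>\<^bsub>cocycle_group U Q E\<^esub>"
    by (simp add: cocycle_group_def cochain_eq_iff) (simp add: S_def cochain_def T_closed l_neg)
  then show "S \<otimes>\<^bsub>cocycle_group U Q E\<^esub> T = \<one>\<^bsub>cocycle_group U Q E\<^esub>" .
  have "compatible U Q E (\<lambda>f xs. S f xs \<oplus>\<^bsub>E\<^esub> T f xs)"
    using cocycle_group_one_closed unfolding inv[symmetric] by (simp add: cocycle_group_def compatible_cochain)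
  note sum = compatibleD[OF this]
  have "compatible U Q E S"
  proof (rule compatibleI)
    fix t g and v :: "nat \<Rightarrow> 'u"
    assume id: "identity_of TYPE('u) U t g" and wf: "wf_trm U t" "wf_trm U g"
      and v: "\<And>i. v i \<in> carrier Q"
    have "partial_eval E Q S v t \<oplus>\<^bsub>E\<^esub> partial_eval E Q T v t
        = partial_eval E Q S v g \<oplus>\<^bsub>E\<^esub> partial_eval E Q T v t"
      using sum[OF id v] compatibleD[OF T(2) id v] by (simp add: partial_eval_add[OF S T(1)] wf v)
    then show "partial_eval E Q S v t = partial_eval E Q S v g"
      using wf v by (simp add: add.right_cancel partial_eval_closed[OF S] partial_eval_closed[OF T(1)])
  qed
  then show "S \<in> carrier (cocycle_group U Q E)"
    using S by (simp add: cocycle_group_def)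
qed

lemma group_cocycle_group: "group (cocycle_group U Q E)"
proof (rule groupI)
  fix R S T assume "R \<in> carrier (cocycle_group U Q E)" "S \<in> carrier (cocycle_group U Q E)"
    "T \<in> carrier (cocycle_group U Q E)"
  then have "R f xs \<in> carrier E" "S f xs \<in> carrier E" "T f xs \<in> carrier E"
    if "xs \<in> tuples (arity U f) (carrier Q)" for f xs
    using that by (force simp: cocycle_group_def two_cocycles_def)+
  then show "R \<otimes>\<^bsub>cocycle_group U Q E\<^esub> S \<otimes>\<^bsub>cocycle_group U Q E\<^esub> T
      = R \<otimes>\<^bsub>cocycle_group U Q E\<^esub> (S \<otimes>\<^bsub>cocycle_group U Q E\<^esub> T)"
    by (simp add: cocycle_group_def cochain_eq_iff) (simp add: cochain_def a_assoc)
next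
  fix T assume "T \<in> carrier (cocycle_group U Q E)"
  then have T: "T \<in> two_cocycles U Q E"
    by (simp add: cocycle_group_def)
  then have "T f xs \<in> carrier E" if "xs \<in> tuples (arity U f) (carrier Q)" for f xs
    using that by (auto simp: two_cocycles_def)
  then have "cochain U Q (\<lambda>f xs. cochain U Q (\<lambda>f xs. \<zero>\<^bsub>E\<^esub>) f xs \<oplus>\<^bsub>E\<^esub> T f xs) = cochain U Q T"
    by (simp add: cochain_eq_iff) (simp add: cochain_def)
  then show "\<one>\<^bsub>cocycle_group U Q E\<^esub> \<otimes>\<^bsub>cocycle_group U Q E\<^esub> T = T"
    using cochain_two_cocycle[OF T] by (simp add: cocycle_group_def)
qed (use cocycle_group_add_closed cocycle_group_one_closed cocycle_group_left_inverse in auto)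

lemma subgroup_coboundaries: "subgroup (coboundaries U Q E) (cocycle_group U Q E)"
proof -
  interpret G: group "cocycle_group U Q E" by (rule group_cocycle_group)
  show ?thesis
  proof (rule G.subgroupI)
    show "coboundaries U Q E \<subseteq> carrier (cocycle_group U Q E)"
      using coboundary_in_cocycle_group by (auto simp: coboundaries_def)
    have "(\<lambda>q. \<zero>\<^bsub>E\<^esub>) \<in> carrier Q \<rightarrow> carrier E" by simp
    then show "coboundaries U Q E \<noteq> {}"
      unfolding coboundaries_def by blast
  next
    fix S assume "S \<in> coboundaries U Q E"
    then obtain h where h: "h \<in> carrier Q \<rightarrow> carrier E" and S: "S = coboundary h"
      by (auto simp: coboundaries_def)
    have h': "(\<lambda>q. \<ominus>\<^bsub>E\<^esub> h q) \<in> carrier Q \<rightarrow> carrier E"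
      using h by auto
    have "coboundary (\<lambda>q. \<ominus>\<^bsub>E\<^esub> h q) \<otimes>\<^bsub>cocycle_group U Q E\<^esub> S = coboundary (\<lambda>q. \<zero>\<^bsub>E\<^esub>)"
      unfolding S by (rule coboundary_add[OF h' h]) (use h in \<open>auto simp: l_neg dest: funcset_mem\<close>)
    then have "inv\<^bsub>cocycle_group U Q E\<^esub> S = coboundary (\<lambda>q. \<ominus>\<^bsub>E\<^esub> h q)"
      using coboundary_in_cocycle_group[OF h] coboundary_in_cocycle_group[OF h'] S
        coboundary_zero[of "\<lambda>q. \<zero>\<^bsub>E\<^esub>"]
      by (intro G.inv_equality) auto
    then show "inv\<^bsub>cocycle_group U Q E\<^esub> S \<in> coboundaries U Q E"
      using h' unfolding coboundaries_def by blast
  next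
    fix S T assume "S \<in> coboundaries U Q E" "T \<in> coboundaries U Q E"
    then obtain h k where h: "h \<in> carrier Q \<rightarrow> carrier E" "S = coboundary h"
      and k: "k \<in> carrier Q \<rightarrow> carrier E" "T = coboundary k"
      by (auto simp: coboundaries_def)
    then have "S \<otimes>\<^bsub>cocycle_group U Q E\<^esub> T = coboundary (\<lambda>q. h q \<oplus>\<^bsub>E\<^esub> k q)"
      by (simp add: coboundary_add)
    moreover have "(\<lambda>q. h q \<oplus>\<^bsub>E\<^esub> k q) \<in> carrier Q \<rightarrow> carrier E"
      using h(1) k(1) by auto
    ultimately show "S \<otimes>\<^bsub>cocycle_group U Q E\<^esub> T \<in> coboundaries U Q E"
      unfolding coboundaries_def by blast
  qed
qed

text \<open>Two cosets agree iff one representative lies in the coset of the other. All comparisons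
  with homomorphisms use this pointwise form, where \<open>h\<close> supplies the correction term of
  a map between twisted products.\<close>

lemma cohomology_class_eq_iff:
  assumes S: "S \<in> carrier (cocycle_group U Q E)" and T: "T \<in> carrier (cocycle_group U Q E)"
  shows "cohomology_class U Q E S = cohomology_class U Q E T \<longleftrightarrow>
    (\<exists>h\<in>carrier Q \<rightarrow> carrier E. \<forall>f. \<forall>xs\<in>tuples (arity U f) (carrier Q).
       S f xs = (koper E f (map h xs) \<ominus>\<^bsub>E\<^esub> h (oper Q f xs)) \<oplus>\<^bsub>E\<^esub> T f xs)"
proof -
  interpret G: group "cocycle_group U Q E" by (rule group_cocycle_group)
  have "cohomology_class U Q E S = cohomology_class U Q E T \<longleftrightarrow> S \<in> cohomology_class U Q E T"
    unfolding cohomology_class_def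
    using G.repr_independence[OF _ T subgroup_coboundaries] G.rcos_self[OF S subgroup_coboundaries] by metis
  also have "\<dots> \<longleftrightarrow> (\<exists>h\<in>carrier Q \<rightarrow> carrier E. S = coboundary h \<otimes>\<^bsub>cocycle_group U Q E\<^esub> T)"
    by (auto simp: cohomology_class_def r_coset_def coboundaries_def)
  also have "\<dots> \<longleftrightarrow> (\<exists>h\<in>carrier Q \<rightarrow> carrier E. cochain U Q S
      = cochain U Q (\<lambda>f xs. (koper E f (map h xs) \<ominus>\<^bsub>E\<^esub> h (oper Q f xs)) \<oplus>\<^bsub>E\<^esub> T f xs))"
  proof -
    have "coboundary h \<otimes>\<^bsub>cocycle_group U Q E\<^esub> T
        = cochain U Q (\<lambda>f xs. (koper E f (map h xs) \<ominus>\<^bsub>E\<^esub> h (oper Q f xs)) \<oplus>\<^bsub>E\<^esub> T f xs)" for h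
      by (simp add: cocycle_group_def cochain_eq_iff) (simp add: cochain_def)
    moreover have "cochain U Q S = S"
      using S by (intro cochain_two_cocycle) (simp add: cocycle_group_def)
    ultimately show ?thesis by simp
  qed
  finally show ?thesis
    by (simp add: cochain_eq_iff)
qed

lemma carrier_H2:
  "carrier (H2 U Q E) = cohomology_class U Q E ` carrier (cocycle_group U Q E)"
  by (auto simp: H2_def FactGroup_def RCOSETS_def cohomology_class_def)

end

section \<open>Change of base and change of coefficients\<close>

text \<open>Partial evaluation commutes with pulling back: the value at \<open>v\<close> in
  \<open>Q\<close> is the value of \<open>S\<close> at the composite of \<open>\<gamma>\<close> with
  \<open>v\<close> in \<open>P\<close>, where compatibility is known.\<close>

lemma pull_back_in_cocycle_group:
  fixes U :: "'f variety" and Q :: "('f, 'u) alg" and E :: "('f, 's, 'u) kernel_alg"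
  assumes "central_datum U Q E" "central_datum U P E"
    and S: "S \<in> carrier (cocycle_group U P E)" and \<gamma>: "\<gamma> \<in> alg_hom U Q P"
  shows "cochain U Q (\<lambda>f qs. S f (map \<gamma> qs)) \<in> carrier (cocycle_group U Q E)"
proof -
  interpret Q: central_data U Q E by (unfold_locales) (rule assms(1))
  interpret P: central_data U P E by (unfold_locales) (rule assms(2))
  have S': "S \<in> two_cocycles U P E" "compatible U P E S"
    using S by (auto simp: cocycle_group_def)
  have "cochain U Q (\<lambda>f qs. S f (map \<gamma> qs)) \<in> two_cocycles U Q E"
    by (rule Q.cochain_in_two_cocycles)
      (auto intro!: P.two_cocycle_closed[OF S'(1)] alg_homD(1)[OF \<gamma>] dest: tuplesD)
  moreover have pe: "partial_eval E Q (\<lambda>f qs. S f (map \<gamma> qs)) v t = partial_eval E P S (\<lambda>i. \<gamma> (v i)) t"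
    if "wf_trm U t" "\<And>i. v i \<in> carrier Q" for v and t :: "('f, nat) trm"
    using that(1)
  proof (induction t)
    case (Fun f ts)
    have "map (partial_eval E Q (\<lambda>f qs. S f (map \<gamma> qs)) v) ts
        = map (partial_eval E P S (\<lambda>i. \<gamma> (v i))) ts"
      using Fun by auto
    moreover have "map \<gamma> (map (eval Q v) ts) = map (eval P (\<lambda>i. \<gamma> (v i))) ts"
      using Fun.prems that(2) by (auto intro!: eval_hom[OF Q.universal_algebra_base \<gamma>])
    ultimately show ?case
      by (simp del: map_map map_eq_conv)
  qed simp
  have "compatible U Q E (\<lambda>f qs. S f (map \<gamma> qs))"
    using compatibleD[OF S'(2)] alg_homD(1)[OF \<gamma>] by (intro compatibleI) (simp add: pe)
  ultimately show ?thesis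
    by (simp add: cocycle_group_def Q.compatible_cochain)
qed

lemma kernel_HomD:
  fixes U :: "'f variety"
  assumes "\<phi> \<in> carrier (kernel_Hom U B E)"
  shows "\<phi> \<zero>\<^bsub>B\<^esub> = \<zero>\<^bsub>E\<^esub>" "x \<in> carrier B \<Longrightarrow> \<phi> x \<in> carrier E"
    and "xs \<in> tuples (arity U f) (carrier B) \<Longrightarrow> \<phi> (koper B f xs) = koper E f (map \<phi> xs)"
  using assms alg_homD[of \<phi> U "kalg B" "kalg E"] by (auto simp: kernel_Hom_def kalg_def)

text \<open>Addition is a term operation with the parameter \<open>0\<close>: \<open>x + y = m(x, 0, y)\<close>.\<close>

lemma kernel_Hom_add:
  fixes U :: "'f variety" and Q :: "('f, 'u) alg" and B :: "('f, 'r, 'u) kernel_alg"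
    and E :: "('f, 's, 'u) kernel_alg"
  assumes "central_datum U Q B" "central_datum U Q E" "arity U (dsym U) = 3"
    and \<phi>: "\<phi> \<in> carrier (kernel_Hom U B E)" and xy: "x \<in> carrier B" "y \<in> carrier B"
  shows "\<phi> (x \<oplus>\<^bsub>B\<^esub> y) = \<phi> x \<oplus>\<^bsub>E\<^esub> \<phi> y"
proof -
  interpret B: central_data U Q B by (unfold_locales) (rule assms(1))
  interpret E: central_data U Q E by (unfold_locales) (rule assms(2))
  have "\<phi> (koper B (dsym U) [x, \<zero>\<^bsub>B\<^esub>, y]) = koper E (dsym U) (map \<phi> [x, \<zero>\<^bsub>B\<^esub>, y])"
    using assms(3) xy by (intro kernel_HomD(3)[OF \<phi>]) (auto simp: tuples_def)
  then show ?thesis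
    using xy kernel_HomD(1,2)[OF \<phi>]
    by (simp add: B.koper_dsym E.koper_dsym a_minus_def)
qed

text \<open>As \<open>\<phi>\<close> is additive and commutes with the operations, it maps the
  partial value for \<open>T\<close> to the one for the composed cochain, so equal values stay
  equal.\<close>

lemma push_forward_in_cocycle_group:
  fixes U :: "'f variety" and Q :: "('f, 'u) alg" and B :: "('f, 'r, 'u) kernel_alg"
  assumes "central_datum U Q B" "central_datum U Q E" and m: "arity U (dsym U) = 3"
    and T: "T \<in> carrier (cocycle_group U Q B)" and \<phi>: "\<phi> \<in> carrier (kernel_Hom U B E)"
  shows "cochain U Q (\<lambda>f qs. \<phi> (T f qs)) \<in> carrier (cocycle_group U Q E)"
proof -
  interpret B: central_data U Q B by (unfold_locales) (rule assms(1))
  interpret E: central_data U Q E by (unfold_locales) (rule assms(2))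
  have T': "T \<in> two_cocycles U Q B" "compatible U Q B T"
    using T by (auto simp: cocycle_group_def)
  have "cochain U Q (\<lambda>f qs. \<phi> (T f qs)) \<in> two_cocycles U Q E"
    using T'(1) by (intro E.cochain_in_two_cocycles kernel_HomD(2)[OF \<phi>]) (auto simp: two_cocycles_def)
  moreover have pe: "partial_eval E Q (\<lambda>f qs. \<phi> (T f qs)) v t = \<phi> (partial_eval B Q T v t)"
    if "wf_trm U t" "\<And>i. v i \<in> carrier Q" for v and t :: "('f, nat) trm"
    using that(1)
  proof (induction t)
    case (Var x)
    then show ?case by (simp add: kernel_HomD(1)[OF \<phi>])
  next
    case (Fun f ts)
    have cl: "partial_eval B Q T v t \<in> carrier B" "eval Q v t \<in> carrier Q" if "t \<in> set ts" for t
      using that Fun.prems \<open>\<And>i. v i \<in> carrier Q\<close>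
      by (auto intro!: B.partial_eval_closed[OF T'(1)] eval_closed[OF B.universal_algebra_base])
    have "map (partial_eval E Q (\<lambda>f qs. \<phi> (T f qs)) v) ts = map \<phi> (map (partial_eval B Q T v) ts)"
      using Fun by auto
    moreover have "\<phi> (koper B f (map (partial_eval B Q T v) ts))
        = koper E f (map \<phi> (map (partial_eval B Q T v) ts))"
      using Fun.prems cl by (intro kernel_HomD(3)[OF \<phi>] map_in_tuples) auto
    moreover have "koper B f (map (partial_eval B Q T v) ts) \<in> carrier B"
      using Fun.prems cl by (auto intro!: B.koper_closed)
    moreover have "T f (map (eval Q v) ts) \<in> carrier B"
      using Fun.prems cl by (auto intro!: B.two_cocycle_closed[OF T'(1)])
    ultimately show ?case
      using kernel_Hom_add[OF assms(1-3) \<phi>] by (simp del: map_map map_eq_conv)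
  qed
  have "compatible U Q E (\<lambda>f qs. \<phi> (T f qs))"
    using compatibleD[OF T'(2)] by (intro compatibleI) (simp add: pe)
  ultimately show ?thesis
    by (simp add: cocycle_group_def E.compatible_cochain)
qed

text \<open>Pushing forward already lands in the cohomology group, so only the inclusion in the
  other direction is left to check.\<close>

lemma transgression_surjectiveI:
  fixes U :: "'f variety" and Q :: "('f, 'u) alg" and B :: "('f, 'r, 'u) kernel_alg"
    and E :: "('f, 's, 'u) kernel_alg"
  assumes "central_datum U Q B" "central_datum U Q E" "arity U (dsym U) = 3"
    and "T \<in> carrier (cocycle_group U Q B)"
    and "\<And>R. R \<in> carrier (cocycle_group U Q E) \<Longrightarrow>
      \<exists>\<phi>\<in>carrier (kernel_Hom U B E). transgression U Q E T \<phi> = cohomology_class U Q E R"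
  shows "transgression_surjective U Q B E T"
proof -
  interpret E: central_data U Q E by (unfold_locales) (rule assms(2))
  have "transgression U Q E T \<phi> \<in> cohomology_class U Q E ` carrier (cocycle_group U Q E)"
    if "\<phi> \<in> carrier (kernel_Hom U B E)" for \<phi>
    unfolding transgression_def by (rule imageI) (rule push_forward_in_cocycle_group[OF assms(1-4) that])
  moreover have "cohomology_class U Q E R \<in> transgression U Q E T ` carrier (kernel_Hom U B E)"
    if "R \<in> carrier (cocycle_group U Q E)" for R
    using assms(5)[OF that] by (metis imageI)
  ultimately show ?thesis
    unfolding transgression_surjective_def E.carrier_H2 by blast
qed

section \<open>Homomorphisms between twisted products\<close>

lemma hom_twisted_product_if_transgression:
  fixes U :: "'f variety" and Q :: "('f, 'u) alg"
  assumes QB: "central_datum U Q B" and QE: "central_datum U Q E" and PE: "central_datum U P E"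
    and m: "arity U (dsym U) = 3"
    and T: "T \<in> carrier (cocycle_group U Q B)" and S: "S \<in> carrier (cocycle_group U P E)"
    and \<gamma>: "\<gamma> \<in> alg_hom U Q P" and \<phi>: "\<phi> \<in> carrier (kernel_Hom U B E)"
    and eq: "transgression U Q E T \<phi> = cohomology_class U Q E (cochain U Q (\<lambda>f qs. S f (map \<gamma> qs)))"
  shows "\<exists>k\<in>alg_hom U (twisted_product B T Q) (twisted_product E S P).
    \<forall>x\<in>carrier (twisted_product B T Q). snd (k x) = \<gamma> (snd x)"
proof -
  interpret QB: central_data U Q B by (unfold_locales) (rule QB)
  interpret QE: central_data U Q E by (unfold_locales) (rule QE)
  interpret PE: central_data U P E by (unfold_locales) (rule PE)
  have T': "T \<in> two_cocycles U Q B" and S': "S \<in> two_cocycles U P E"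
    using T S by (auto simp: cocycle_group_def)
  \<comment> \<open>The given equation of classes is reversed first, so the coboundary of
    \<open>h\<close> is added to \<open>\<phi> \<circ> T\<close>. This orientation is why
    \<open>h\<close> is subtracted in \<open>k\<close> below.\<close>
  obtain h where h: "h \<in> carrier Q \<rightarrow> carrier E"
    and h_eq: "\<And>f qs. qs \<in> tuples (arity U f) (carrier Q) \<Longrightarrow>
      cochain U Q (\<lambda>f qs. S f (map \<gamma> qs)) f qs
        = (koper E f (map h qs) \<ominus>\<^bsub>E\<^esub> h (oper Q f qs)) \<oplus>\<^bsub>E\<^esub> cochain U Q (\<lambda>f qs. \<phi> (T f qs)) f qs"
    using eq[symmetric] QE.cohomology_class_eq_iff pull_back_in_cocycle_group[OF QE PE S \<gamma>]
      push_forward_in_cocycle_group[OF QB QE m T \<phi>]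
    unfolding transgression_def by metis
  define k where "k = (\<lambda>(b, q). (\<phi> b \<ominus>\<^bsub>E\<^esub> h q, \<gamma> q))"
  have "k (oper (twisted_product B T Q) f zs) = oper (twisted_product E S P) f (map k zs)"
    if zs: "zs \<in> tuples (arity U f) (carrier B \<times> carrier Q)" for f zs
  proof -
    have len: "length zs = arity U f" and fs: "\<And>z. z \<in> set zs \<Longrightarrow> fst z \<in> carrier B"
      "\<And>z. z \<in> set zs \<Longrightarrow> snd z \<in> carrier Q"
      using zs by (auto simp: tuples_def)
    have qs: "map snd zs \<in> tuples (arity U f) (carrier Q)"
      and bs: "map fst zs \<in> tuples (arity U f) (carrier B)"
      using len fs by (auto intro!: map_in_tuples)
    have cl: "koper B f (map fst zs) \<in> carrier B" "T f (map snd zs) \<in> carrier B"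
      "oper Q f (map snd zs) \<in> carrier Q" "S f (map (\<lambda>z. \<gamma> (snd z)) zs) \<in> carrier E"
      "koper E f (map (\<lambda>z. \<phi> (fst z)) zs) \<in> carrier E" "koper E f (map (\<lambda>z. h (snd z)) zs) \<in> carrier E"
      using len fs h kernel_HomD(2)[OF \<phi>] alg_homD(1)[OF \<gamma>]
      by (auto intro!: QB.koper_closed QB.two_cocycle_closed[OF T'] PE.two_cocycle_closed[OF S']
          QB.base_closed QE.koper_closed)
    have h_cl: "h (oper Q f (map snd zs)) \<in> carrier E"
      using h cl by auto
    have k1: "\<phi> (koper B f (map fst zs) \<oplus>\<^bsub>B\<^esub> T f (map snd zs))
        = koper E f (map (\<lambda>z. \<phi> (fst z)) zs) \<oplus>\<^bsub>E\<^esub> \<phi> (T f (map snd zs))"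
      using kernel_Hom_add[OF QB QE m \<phi>] kernel_HomD(3)[OF \<phi> bs] cl by (simp add: comp_def)
    have k2: "koper E f (map (\<lambda>z. \<phi> (fst z) \<ominus>\<^bsub>E\<^esub> h (snd z)) zs)
        = koper E f (map (\<lambda>z. \<phi> (fst z)) zs) \<ominus>\<^bsub>E\<^esub> koper E f (map (\<lambda>z. h (snd z)) zs)"
      using len fs h kernel_HomD(2)[OF \<phi>] by (intro QE.koper_minus) auto
    have k3: "S f (map (\<lambda>z. \<gamma> (snd z)) zs) = (koper E f (map (\<lambda>z. h (snd z)) zs)
        \<ominus>\<^bsub>E\<^esub> h (oper Q f (map snd zs))) \<oplus>\<^bsub>E\<^esub> \<phi> (T f (map snd zs))"
      using h_eq[OF qs] qs by (simp add: cochain_def comp_def)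
    \<comment> \<open>On the right, the operation applied to the values of \<open>h\<close> occurs
      once with each sign, in \<open>k2\<close> and in \<open>k3\<close>, and cancels.\<close>
    have "\<phi> (koper B f (map fst zs) \<oplus>\<^bsub>B\<^esub> T f (map snd zs)) \<ominus>\<^bsub>E\<^esub> h (oper Q f (map snd zs))
        = koper E f (map (\<lambda>z. \<phi> (fst z) \<ominus>\<^bsub>E\<^esub> h (snd z)) zs) \<oplus>\<^bsub>E\<^esub> S f (map (\<lambda>z. \<gamma> (snd z)) zs)"
      unfolding k1 k2 k3 using cl h_cl kernel_HomD(2)[OF \<phi> cl(2)]
      by (simp add: QE.a_assoc[symmetric] QE.minus_telescope) (simp add: a_minus_def QE.a_ac)
    then show ?thesis
      using alg_homD(2)[OF \<gamma> qs]
      by (simp add: twisted_product_def k_def case_prod_beta comp_def)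
  qed
  then have "k \<in> alg_hom U (twisted_product B T Q) (twisted_product E S P)"
    using h kernel_HomD(2)[OF \<phi>] alg_homD(1)[OF \<gamma>]
    by (auto simp: alg_hom_def k_def twisted_product_def)
  moreover have "\<forall>x\<in>carrier (twisted_product B T Q). snd (k x) = \<gamma> (snd x)"
    by (simp add: k_def case_prod_beta)
  ultimately show ?thesis by blast
qed

text \<open>Compatibility with m(x, x, y) = y: the right side is a variable, with partial value 0,
  and on the left m of three zeros vanishes, so only the value of \<open>T\<close> remains.\<close>

lemma cocycle_dsym_zero:
  fixes U :: "'f variety" and Q :: "('f, 'u) alg"
  assumes "has_difference_term TYPE('u) U" and "central_datum U Q B"
    and T: "T \<in> carrier (cocycle_group U Q B)" and q: "q \<in> carrier Q" "q' \<in> carrier Q"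
  shows "T (dsym U) [q, q, q'] = \<zero>\<^bsub>B\<^esub>" "oper Q (dsym U) [q, q, q'] = q'"
proof -
  interpret B: central_data U Q B by (unfold_locales) (rule assms(2))
  let ?t = "Fun (dsym U) [Var 0, Var 0, Var 1] :: ('f, nat) trm"
  let ?v = "\<lambda>i :: nat. if i = 0 then q else q'"
  \<comment> \<open>\<open>identity_of\<close> ranges over the members of the variety carried by
    \<open>'u\<close>, the same class as in the difference term condition.\<close>
  have id: "identity_of TYPE('u) U ?t (Var 1)"
    using assms(1) by (simp add: identity_of_def has_difference_term_def satisfies_def)
  have "compatible U Q B T"
    using T by (simp add: cocycle_group_def)
  then have "partial_eval B Q T ?v ?t = partial_eval B Q T ?v (Var 1)"
    by (rule compatibleD) (use id q in auto)
  moreover have "[q, q, q'] \<in> tuples (arity U (dsym U)) (carrier Q)"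
    using assms(1) q by (simp add: tuples_def has_difference_term_def)
  then have "T (dsym U) [q, q, q'] \<in> carrier B"
    using T by (auto simp: cocycle_group_def two_cocycles_def)
  ultimately show "T (dsym U) [q, q, q'] = \<zero>\<^bsub>B\<^esub>"
    by (simp add: B.koper_dsym a_minus_def)
  show "oper Q (dsym U) [q, q, q'] = q'"
    using B.satisfies_identity(1)[OF id, of ?v] q by simp
qed

lemma transgression_if_hom_twisted_product:
  fixes U :: "'f variety" and Q :: "('f, 'u) alg"
  assumes dt: "has_difference_term TYPE('u) U"
    and QB: "central_datum U Q B" and QE: "central_datum U Q E" and PE: "central_datum U P E"
    and T: "T \<in> carrier (cocycle_group U Q B)" and S: "S \<in> carrier (cocycle_group U P E)"
    and \<gamma>: "\<gamma> \<in> alg_hom U Q P"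
    and k: "k \<in> alg_hom U (twisted_product B T Q) (twisted_product E S P)"
    and over: "\<And>x. x \<in> carrier (twisted_product B T Q) \<Longrightarrow> snd (k x) = \<gamma> (snd x)"
  shows "\<exists>\<phi>\<in>carrier (kernel_Hom U B E).
    transgression U Q E T \<phi> = cohomology_class U Q E (cochain U Q (\<lambda>f qs. S f (map \<gamma> qs)))"
proof -
  interpret QB: central_data U Q B by (unfold_locales) (rule QB)
  interpret QE: central_data U Q E by (unfold_locales) (rule QE)
  interpret PE: central_data U P E by (unfold_locales) (rule PE)
  have T': "T \<in> two_cocycles U Q B" and S': "S \<in> two_cocycles U P E"
    using T S by (auto simp: cocycle_group_def)
  have m: "arity U (dsym U) = 3"
    using dt by (simp add: has_difference_term_def)
  \<comment> \<open>The kernel component of \<open>k\<close>; the other component is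
    \<open>\<gamma> q\<close>. The homomorphism property of \<open>k\<close> becomes the single
    equation \<open>c_oper\<close>.\<close>
  define c where "c b q = fst (k (b, q))" for b q
  have k_eq: "k (b, q) = (c b q, \<gamma> q)" and c_closed: "c b q \<in> carrier E"
    if "b \<in> carrier B" "q \<in> carrier Q" for b q
    using over[of "(b, q)"] alg_homD(1)[OF k, of "(b, q)"] that
    by (auto simp: c_def twisted_product_def prod_eq_iff)
  have c_oper: "c (koper B f (map b xs) \<oplus>\<^bsub>B\<^esub> T f (map q xs)) (oper Q f (map q xs))
      = koper E f (map (\<lambda>x. c (b x) (q x)) xs) \<oplus>\<^bsub>E\<^esub> S f (map (\<lambda>x. \<gamma> (q x)) xs)"
    if "length xs = arity U f" "\<And>x. x \<in> set xs \<Longrightarrow> b x \<in> carrier B" "\<And>x. x \<in> set xs \<Longrightarrow> q x \<in> carrier Q"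
    for f b q and xs :: "'x list"
  proof -
    have "map (\<lambda>x. (b x, q x)) xs \<in> tuples (arity U f) (carrier (twisted_product B T Q))"
      using that by (auto intro!: map_in_tuples simp: twisted_product_def)
    note alg_homD(2)[OF k this]
    moreover have "map k (map (\<lambda>x. (b x, q x)) xs) = map (\<lambda>x. (c (b x) (q x), \<gamma> (q x))) xs"
      using that by (simp add: k_eq)
    ultimately show ?thesis
      by (simp add: twisted_product_def c_def comp_def del: map_map) (simp add: comp_def)
  qed
  \<comment> \<open>apply \<open>k\<close> to \<open>m((b, q), (0, q), (b', q')) = (b + b', q')\<close>\<close>
  have c_dsym: "c (b \<oplus>\<^bsub>B\<^esub> b') q' = (c b q \<ominus>\<^bsub>E\<^esub> c \<zero>\<^bsub>B\<^esub> q) \<oplus>\<^bsub>E\<^esub> c b' q'"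
    if b: "b \<in> carrier B" "b' \<in> carrier B" and q: "q \<in> carrier Q" "q' \<in> carrier Q" for b b' q q'
  proof -
    let ?zs = "[(b, q), (\<zero>\<^bsub>B\<^esub>, q), (b', q')]"
    have "c (koper B (dsym U) (map fst ?zs) \<oplus>\<^bsub>B\<^esub> T (dsym U) (map snd ?zs)) (oper Q (dsym U) (map snd ?zs))
        = koper E (dsym U) (map (\<lambda>z. c (fst z) (snd z)) ?zs) \<oplus>\<^bsub>E\<^esub>
          S (dsym U) (map (\<lambda>z. \<gamma> (snd z)) ?zs)"
      by (rule c_oper) (use m b q in auto)
    then have "c (koper B (dsym U) [b, \<zero>\<^bsub>B\<^esub>, b'] \<oplus>\<^bsub>B\<^esub> T (dsym U) [q, q, q']) (oper Q (dsym U) [q, q, q'])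
        = koper E (dsym U) [c b q, c \<zero>\<^bsub>B\<^esub> q, c b' q'] \<oplus>\<^bsub>E\<^esub> S (dsym U) [\<gamma> q, \<gamma> q, \<gamma> q']"
      by simp
    then show ?thesis
      using b q cocycle_dsym_zero[OF dt QB T] cocycle_dsym_zero(1)[OF dt PE S] alg_homD(1)[OF \<gamma>]
      by (simp add: QB.koper_dsym QE.koper_dsym c_closed a_minus_def)
  qed
  \<comment> \<open>An arbitrary base point. The increment of \<open>c\<close> from 0 to
    \<open>b\<close> is measured in the fibre over \<open>q0\<close>, and \<open>c_split\<close>
    shows that every other fibre gives the same increment.\<close>
  obtain q0 where q0: "q0 \<in> carrier Q"
    using QB.universal_algebra_base by (auto simp: universal_algebra_def)
  define \<phi> where "\<phi> = (\<lambda>b\<in>carrier B. c b q0 \<ominus>\<^bsub>E\<^esub> c \<zero>\<^bsub>B\<^esub> q0)"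
  have \<phi>_closed: "\<phi> b \<in> carrier E" if "b \<in> carrier B" for b
    using that q0 by (simp add: \<phi>_def c_closed)
  define h where "h = c \<zero>\<^bsub>B\<^esub>"
  \<comment> \<open>Here \<open>c_dsym\<close> is used with second kernel entry 0 and two base
    points, which moves the increment from the fibre over \<open>q0\<close> to the one over
    \<open>q\<close>.\<close>
  have c_split: "c b q = \<phi> b \<oplus>\<^bsub>E\<^esub> h q" if "b \<in> carrier B" "q \<in> carrier Q" for b q
    using c_dsym[of b "\<zero>\<^bsub>B\<^esub>" q0 q] that q0 by (simp add: \<phi>_def h_def)
  have \<phi>_zero: "\<phi> \<zero>\<^bsub>B\<^esub> = \<zero>\<^bsub>E\<^esub>"
    using q0 by (simp add: \<phi>_def c_closed a_minus_def QE.r_neg)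
  have \<phi>_add: "\<phi> (b \<oplus>\<^bsub>B\<^esub> b') = \<phi> b \<oplus>\<^bsub>E\<^esub> \<phi> b'" if "b \<in> carrier B" "b' \<in> carrier B" for b b'
    using c_dsym[of b b' q0 q0] that q0 c_closed[of _ q0]
    by (simp add: \<phi>_def a_minus_def QE.a_assoc)
  have h: "h \<in> carrier Q \<rightarrow> carrier E"
    by (simp add: h_def c_closed)
  note closed = \<phi>_closed funcset_mem[OF h] alg_homD(1)[OF \<gamma>] QB.koper_closed QE.koper_closed QB.base_closed
    QB.two_cocycle_closed[OF T'] PE.two_cocycle_closed[OF S']
  \<comment> \<open>Splitting \<open>c\<close> in \<open>c_oper\<close> puts the kernel arguments
    into one summand on each side and the base arguments into the rest. The two groups can be varied
    independently.\<close>
  have \<phi>_koper: "\<phi> (koper B f (map b xs)) \<oplus>\<^bsub>E\<^esub> (\<phi> (T f (map q xs)) \<oplus>\<^bsub>E\<^esub> h (oper Q f (map q xs)))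
      = koper E f (map (\<lambda>x. \<phi> (b x)) xs) \<oplus>\<^bsub>E\<^esub>
        (koper E f (map (\<lambda>x. h (q x)) xs) \<oplus>\<^bsub>E\<^esub> S f (map (\<lambda>x. \<gamma> (q x)) xs))"
    if xs: "length xs = arity U f" "\<And>x. x \<in> set xs \<Longrightarrow> b x \<in> carrier B" "\<And>x. x \<in> set xs \<Longrightarrow> q x \<in> carrier Q"
    for f b q and xs :: "'u list"
  proof -
    have cl: "koper B f (map b xs) \<in> carrier B" "T f (map q xs) \<in> carrier B"
      "oper Q f (map q xs) \<in> carrier Q" "S f (map (\<lambda>x. \<gamma> (q x)) xs) \<in> carrier E"
      "koper E f (map (\<lambda>x. \<phi> (b x)) xs) \<in> carrier E" "koper E f (map (\<lambda>x. h (q x)) xs) \<in> carrier E"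
      by (simp_all add: closed xs)
    have "map (\<lambda>x. c (b x) (q x)) xs = map (\<lambda>x. \<phi> (b x) \<oplus>\<^bsub>E\<^esub> h (q x)) xs"
      using xs by (simp add: c_split)
    then have "koper E f (map (\<lambda>x. c (b x) (q x)) xs)
        = koper E f (map (\<lambda>x. \<phi> (b x)) xs) \<oplus>\<^bsub>E\<^esub> koper E f (map (\<lambda>x. h (q x)) xs)"
      by (simp add: QE.koper_add closed xs del: map_eq_conv)
    moreover have "c (koper B f (map b xs) \<oplus>\<^bsub>B\<^esub> T f (map q xs)) (oper Q f (map q xs))
        = (\<phi> (koper B f (map b xs)) \<oplus>\<^bsub>E\<^esub> \<phi> (T f (map q xs))) \<oplus>\<^bsub>E\<^esub> h (oper Q f (map q xs))"
      using cl by (simp add: c_split[of "_ \<oplus>\<^bsub>B\<^esub> _"] \<phi>_add)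
    ultimately show ?thesis
      using c_oper[of xs f b q, OF xs] by (simp add: QE.a_assoc cl closed)
  qed
  \<comment> \<open>Setting all kernel arguments to 0 isolates the base part, which is the
    cohomology relation.\<close>
  have T_h: "\<phi> (T f (map q xs)) \<oplus>\<^bsub>E\<^esub> h (oper Q f (map q xs))
      = koper E f (map (\<lambda>x. h (q x)) xs) \<oplus>\<^bsub>E\<^esub> S f (map (\<lambda>x. \<gamma> (q x)) xs)"
    if "length xs = arity U f" "\<And>x. x \<in> set xs \<Longrightarrow> q x \<in> carrier Q" for f q and xs :: "'u list"
  proof -
    have "T f (map q xs) \<in> carrier B" "h (oper Q f (map q xs)) \<in> carrier E"
      "S f (map (\<lambda>x. \<gamma> (q x)) xs) \<in> carrier E" "koper E f (map (\<lambda>x. h (q x)) xs) \<in> carrier E"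
      by (simp_all add: closed that)
    then show ?thesis
      using \<phi>_koper[of xs f "\<lambda>x. \<zero>\<^bsub>B\<^esub>" q] that
      by (simp add: QB.koper_zero QE.koper_zero \<phi>_zero \<phi>_closed)
  qed
  have "\<phi> (koper B f bs) = koper E f (map \<phi> bs)" if bs: "bs \<in> tuples (arity U f) (carrier B)" for f bs
  proof -
    have cl: "length bs = arity U f" "koper B f bs \<in> carrier B" "koper E f (map \<phi> bs) \<in> carrier E"
      "T f (map (\<lambda>x. q0) bs) \<in> carrier B" "oper Q f (map (\<lambda>x. q0) bs) \<in> carrier Q"
      using QB.koper_closed[of bs f "\<lambda>x. x"] by (simp_all add: closed tuplesD[OF bs] q0)
    \<comment> \<open>With all base arguments equal to \<open>q0\<close>, \<open>T_h\<close>
      identifies the base parts of the two sides. Cancelling this common value leaves the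
      homomorphism equation for \<open>\<phi>\<close>.\<close>
    let ?x = "\<phi> (T f (map (\<lambda>x. q0) bs)) \<oplus>\<^bsub>E\<^esub> h (oper Q f (map (\<lambda>x. q0) bs))"
    have "\<phi> (koper B f (map (\<lambda>x. x) bs)) \<oplus>\<^bsub>E\<^esub> ?x = koper E f (map \<phi> bs) \<oplus>\<^bsub>E\<^esub> ?x"
      using tuplesD[OF bs] q0 \<phi>_koper[of bs f "\<lambda>x. x" "\<lambda>x. q0"]
      by (simp add: T_h)
    then show ?thesis
      using cl \<phi>_closed funcset_mem[OF h cl(5)] by (simp add: QE.add.right_cancel)
  qed
  then have hom: "\<phi> \<in> carrier (kernel_Hom U B E)"
    using \<phi>_closed \<phi>_zero by (auto simp: kernel_Hom_def alg_hom_def kalg_def \<phi>_def)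
  \<comment> \<open>The witness is \<open>h\<close>, the restriction of \<open>c\<close> to kernel
    component 0: \<open>T_h\<close> solved for the value of \<open>\<phi>\<close> exhibits its
    coboundary.\<close>
  have "\<exists>g\<in>carrier Q \<rightarrow> carrier E. \<forall>f. \<forall>qs\<in>tuples (arity U f) (carrier Q).
      cochain U Q (\<lambda>f qs. \<phi> (T f qs)) f qs
        = (koper E f (map g qs) \<ominus>\<^bsub>E\<^esub> g (oper Q f qs)) \<oplus>\<^bsub>E\<^esub> cochain U Q (\<lambda>f qs. S f (map \<gamma> qs)) f qs"
  proof (intro bexI[OF _ h] allI ballI)
    fix f qs assume qs: "qs \<in> tuples (arity U f) (carrier Q)"
    have cl: "T f qs \<in> carrier B" "h (oper Q f qs) \<in> carrier E"
      "S f (map \<gamma> qs) \<in> carrier E" "koper E f (map h qs) \<in> carrier E"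
      using QB.two_cocycle_closed[OF T', of qs f "\<lambda>x. x"]
      by (simp_all add: closed tuplesD[OF qs] universal_algebra_closed[OF QB.universal_algebra_base qs])
    have "\<phi> (T f qs) = (koper E f (map h qs) \<oplus>\<^bsub>E\<^esub> S f (map \<gamma> qs)) \<ominus>\<^bsub>E\<^esub> h (oper Q f qs)"
      using T_h[of qs f "\<lambda>x. x"] by (intro QE.eq_minusI) (simp_all add: cl closed tuplesD[OF qs])
    then show "cochain U Q (\<lambda>f qs. \<phi> (T f qs)) f qs
        = (koper E f (map h qs) \<ominus>\<^bsub>E\<^esub> h (oper Q f qs)) \<oplus>\<^bsub>E\<^esub> cochain U Q (\<lambda>f qs. S f (map \<gamma> qs)) f qs"
      using qs cl by (simp add: cochain_def a_minus_def QE.a_ac)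
  qed
  then have "transgression U Q E T \<phi> = cohomology_class U Q E (cochain U Q (\<lambda>f qs. S f (map \<gamma> qs)))"
    unfolding transgression_def
    using QE.cohomology_class_eq_iff pull_back_in_cocycle_group[OF QE PE S \<gamma>]
      push_forward_in_cocycle_group[OF QB QE m T hom] by simp
  with hom show ?thesis by blast
qed

section \<open>Twisted products as extensions\<close>

context central_data
begin

text \<open>Partial evaluation collects exactly what the cocycle contributes to the kernel
  component. Additivity of the operations separates this contribution from the value of the term in
  the kernel algebra.\<close>

lemma eval_twisted_product:
  assumes T: "T \<in> two_cocycles U Q E" and "wf_trm U t"
    and v: "\<And>i. fst (v i) \<in> carrier E" "\<And>i. snd (v i) \<in> carrier Q"
  shows "eval (twisted_product E T Q) v t
    = (eval (kalg E) (\<lambda>i. fst (v i)) t \<oplus>\<^bsub>E\<^esub> partial_eval E Q T (\<lambda>i. snd (v i)) t,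
       eval Q (\<lambda>i. snd (v i)) t)"
  using assms(2)
proof (induction t)
  case (Var x)
  then show ?case by (simp add: v)
next
  case (Fun f ts)
  let ?e = "eval (kalg E) (\<lambda>i. fst (v i))" and ?p = "partial_eval E Q T (\<lambda>i. snd (v i))"
    and ?q = "eval Q (\<lambda>i. snd (v i))"
  have len: "length ts = arity U f" and wf: "\<And>t. t \<in> set ts \<Longrightarrow> wf_trm U t"
    using Fun.prems by auto
  note closed = eval_kalg_closed partial_eval_closed[OF T] eval_closed[OF universal_algebra_base]
    koper_closed two_cocycle_closed[OF T] v wf len
  have "map (eval (twisted_product E T Q) v) ts = map (\<lambda>t. (?e t \<oplus>\<^bsub>E\<^esub> ?p t, ?q t)) ts"
    using Fun by auto
  then have "eval (twisted_product E T Q) v (Fun f ts)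
      = (koper E f (map (\<lambda>t. ?e t \<oplus>\<^bsub>E\<^esub> ?p t) ts) \<oplus>\<^bsub>E\<^esub> T f (map ?q ts), oper Q f (map ?q ts))"
    by (simp add: twisted_product_def comp_def del: map_eq_conv)
  then show ?case
    by (simp add: koper_add closed a_assoc)
qed

lemma universal_algebra_twisted_product:
  assumes "T \<in> two_cocycles U Q E"
  shows "universal_algebra U (twisted_product E T Q)"
proof -
  have "oper (twisted_product E T Q) f zs \<in> carrier E \<times> carrier Q"
    if "zs \<in> tuples (arity U f) (carrier E \<times> carrier Q)" for f zs
  proof -
    have "length zs = arity U f" "fst z \<in> carrier E" "snd z \<in> carrier Q" if "z \<in> set zs" for z
      using that \<open>zs \<in> _\<close> by (auto simp: tuples_def)
    then show ?thesis
      using that by (simp add: twisted_product_def koper_closed base_closed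
          two_cocycle_closed[OF assms] tuples_def)
  qed
  then show ?thesis
    using universal_algebra_base zero_closed by (auto simp: universal_algebra_def twisted_product_def)
qed

text \<open>An evaluated term has three ingredients: its value in the kernel algebra, its partial
  value and its value in \<open>Q\<close>. An axiom preserves the first and the last by membership
  in the variety and the middle one by compatibility.\<close>

lemma in_variety_twisted_product:
  assumes "wf_variety U" and T: "T \<in> carrier (cocycle_group U Q E)"
  shows "in_variety U (twisted_product E T Q)"
proof -
  have T': "T \<in> two_cocycles U Q E" "compatible U Q E T"
    using T by (auto simp: cocycle_group_def)
  have "satisfies (twisted_product E T Q) t g" if ax: "(t, g) \<in> axs U" for t g
  proof -
    have wf: "wf_trm U t" "wf_trm U g"
      using assms(1) ax by (auto simp: wf_variety_def)
    have id: "identity_of TYPE('u) U t g"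
      using wf ax by (auto simp: identity_of_def in_variety_def)
    show ?thesis
      unfolding satisfies_def
    proof (intro allI impI)
      fix v :: "nat \<Rightarrow> 'u \<times> 'u" assume "\<forall>i. v i \<in> carrier (twisted_product E T Q)"
      then have v: "fst (v i) \<in> carrier E" "snd (v i) \<in> carrier Q" for i
        by (auto simp: twisted_product_def mem_Times_iff)
      show "eval (twisted_product E T Q) v t = eval (twisted_product E T Q) v g"
        using satisfies_identity(1)[OF id v(2)] satisfies_identity(2)[OF id v(1)]
          compatibleD[OF T'(2) id v(2)]
        by (simp add: eval_twisted_product[OF T'(1)] wf v)
    qed
  qed
  then show ?thesis
    using universal_algebra_twisted_product[OF T'(1)] by (auto simp: in_variety_def)
qed

end

section \<open>Centrality of the kernel\<close>

lemma zero_cong_congruence: "universal_algebra \<tau> A \<Longrightarrow> zero_cong A \<in> congruences \<tau> A"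
proof -
  assume A: "universal_algebra \<tau> A"
  have "xs = ys" if "list_all2 (\<lambda>x y. (x, y) \<in> zero_cong A) xs ys" for xs ys
    using that by (induction rule: list_all2_induct) (auto simp: zero_cong_def)
  moreover have "equiv (carrier A) (zero_cong A)"
    by (auto simp: equiv_def refl_on_def sym_def trans_def zero_cong_def)
  ultimately show ?thesis
    using universal_algebra_closed[OF A] by (auto simp: congruences_def zero_cong_def)
qed

text \<open>The zero congruence is then one of the congruences being intersected, and every
  congruence contains it.\<close>

lemma commutator_eq_zero_cong:
  assumes "universal_algebra \<tau> A" "centralizes \<tau> A \<alpha> \<beta> (zero_cong A)"
  shows "commutator \<tau> A \<alpha> \<beta> = zero_cong A"
proof -
  have "zero_cong A \<subseteq> \<delta>" if "\<delta> \<in> congruences \<tau> A" for \<delta>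
    using that by (auto simp: congruences_def zero_cong_def equiv_def refl_on_def)
  then show ?thesis
    using assms zero_cong_congruence unfolding commutator_def by blast
qed

text \<open>
  A term of a twisted product is additive in the kernel component up to a summand that depends only
  on the component in \<open>Q\<close>; hence the term condition.
\<close>

lemma represented_by_central:
  fixes U :: "'f variety" and A Q :: "('f, 'u) alg" and E :: "('f, 'r, 'u) kernel_alg"
  assumes "represented_by U A \<pi> Q E T"
  shows "central_extension U A \<pi> Q"
proof -
  interpret central_data U Q E
    using assms by unfold_locales (simp add: represented_by_def)
  have A: "universal_algebra U A" and ext: "extension U A \<pi> Q" and T: "T \<in> two_cocycles U Q E"
    using assms by (auto simp: represented_by_def extension_def cocycle_group_def)
  obtain \<psi> where \<psi>: "\<psi> \<in> alg_hom U A (twisted_product E T Q)" "inj_on \<psi> (carrier A)"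
    and over: "\<And>a. a \<in> carrier A \<Longrightarrow> snd (\<psi> a) = \<pi> a"
    using assms by (auto simp: represented_by_def alg_iso_def bij_betw_def)
  have \<psi>_closed: "fst (\<psi> a) \<in> carrier E" "snd (\<psi> a) \<in> carrier Q" if "a \<in> carrier A" for a
    using alg_homD(1)[OF \<psi>(1) that] by (auto simp: twisted_product_def)
  have "centralizes U A (kernel_cong A \<pi>) (one_cong A) (zero_cong A)"
    unfolding centralizes_def
  proof (intro allI impI)
    fix t :: "('f, nat + nat) trm" and a b c d :: "nat \<Rightarrow> 'u"
    assume wf: "wf_trm U t" and "\<forall>i. (a i, b i) \<in> kernel_cong A \<pi>"
      and "\<forall>j. (c j, d j) \<in> one_cong A"
      and eq: "(eval A (case_sum a c) t, eval A (case_sum a d) t) \<in> zero_cong A"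
    then have carr: "a i \<in> carrier A" "b i \<in> carrier A" "c i \<in> carrier A" "d i \<in> carrier A"
      and \<pi>: "\<pi> (a i) = \<pi> (b i)" for i
      by (auto simp: kernel_cong_def one_cong_def)
    let ?fst = "\<lambda>x y i. fst (\<psi> (case_sum x y i))" and ?snd = "\<lambda>x y i. snd (\<psi> (case_sum x y i))"
    have carr2: "case_sum x y i \<in> carrier A" if "\<And>i. x i \<in> carrier A" "\<And>i. y i \<in> carrier A"
      for i and x y :: "nat \<Rightarrow> 'u"
      using that by (cases i) auto
    have \<psi>_eval: "\<psi> (eval A (case_sum x y) t)
        = (eval (kalg E) (?fst x y) t \<oplus>\<^bsub>E\<^esub> partial_eval E Q T (?snd x y) t, eval Q (?snd x y) t)"
      if "\<And>i. x i \<in> carrier A" "\<And>i. y i \<in> carrier A" for x y :: "nat \<Rightarrow> 'u"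
      using carr2[of x y] that
      by (simp add: eval_hom[OF A \<psi>(1) wf] eval_twisted_product[OF T wf] \<psi>_closed)
    \<comment> \<open>The isomorphism lies over \<open>\<pi>\<close>, so related elements share
      their base component, and replacing \<open>a\<close> by \<open>b\<close> changes only kernel
      components.\<close>
    have snd_ab: "?snd a y = ?snd b y" for y
      by (auto simp: fun_eq_iff over carr \<pi> split: sum.split)
    \<comment> \<open>The shift from \<open>a\<close> to \<open>b\<close>; it is 0 on the second
      block, whose variables are left alone. Hence the change in the value of the term is the same
      for \<open>c\<close> and for \<open>d\<close>.\<close>
    define z where "z = (\<lambda>i. case i of Inl i \<Rightarrow> fst (\<psi> (b i)) \<ominus>\<^bsub>E\<^esub> fst (\<psi> (a i)) | Inr (j :: nat) \<Rightarrow> \<zero>\<^bsub>E\<^esub>)"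
    have z_closed: "z i \<in> carrier E" for i
      by (cases i) (auto simp: z_def \<psi>_closed carr)
    have shift: "eval (kalg E) (?fst b y) t = eval (kalg E) z t \<oplus>\<^bsub>E\<^esub> eval (kalg E) (?fst a y) t"
      if y: "\<And>i. y i \<in> carrier A" for y
    proof -
      have "?fst b y i = z i \<oplus>\<^bsub>E\<^esub> ?fst a y i" for i
        by (cases i) (auto simp: z_def \<psi>_closed carr y minus_add_cancel)
      then have "?fst b y = (\<lambda>i. z i \<oplus>\<^bsub>E\<^esub> ?fst a y i)" by blast
      then show ?thesis
        using eval_kalg_add[OF wf, of z "?fst a y"] z_closed \<psi>_closed carr2[OF carr(1) y] by simp
    qed
    have "\<psi> (eval A (case_sum a c) t) = \<psi> (eval A (case_sum a d) t)"
      using eq by (auto simp: zero_cong_def)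
    \<comment> \<open>Both sides differ from the known equation by the same summand, the value of
      the term at \<open>z\<close>.\<close>
    then have "\<psi> (eval A (case_sum b c) t) = \<psi> (eval A (case_sum b d) t)"
      using carr carr2[OF carr(1) carr(3)] carr2[OF carr(1) carr(4)]
        carr2[OF carr(2) carr(3)] carr2[OF carr(2) carr(4)]
      by (simp add: \<psi>_eval snd_ab shift a_assoc eval_kalg_closed[OF wf] z_closed \<psi>_closed
          partial_eval_closed[OF T wf])
    moreover have "eval A (case_sum b c) t \<in> carrier A" "eval A (case_sum b d) t \<in> carrier A"
      using carr carr2 by (auto intro!: eval_closed[OF A wf])
    ultimately show "(eval A (case_sum b c) t, eval A (case_sum b d) t) \<in> zero_cong A"
      using inj_onD[OF \<psi>(2)] by (simp add: zero_cong_def Id_on_iff)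
  qed
  then show ?thesis
    using ext commutator_eq_zero_cong[OF A] by (simp add: central_extension_def)
qed

text \<open>The twisted product lives on pairs, whereas extensions are required to be carried by
  \<open>'u\<close>. An infinite type admits an injection of its square into itself, and the
  structure is transported along it.\<close>

lemma represented_by_exists:
  fixes U :: "'f variety" and Q :: "('f, 'u) alg" and E :: "('f, 'r, 'u) kernel_alg"
  assumes inf: "infinite (UNIV :: 'u set)" and "wf_variety U" and datum: "central_datum U Q E"
    and T: "T \<in> carrier (cocycle_group U Q E)"
  shows "\<exists>(C :: ('f, 'u) alg) \<rho>. represented_by U C \<rho> Q E T"
proof -
  interpret central_data U Q E by (unfold_locales) (rule datum)
  let ?D = "twisted_product E T Q"
  have D: "universal_algebra U ?D" "in_variety U ?D"
    using T in_variety_twisted_product[OF assms(2) T] by (auto simp: in_variety_def)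
  obtain e :: "'u \<times> 'u \<Rightarrow> 'u" where e: "inj e"
    using card_of_Times_same_infinite[OF inf] by (auto simp: card_of_ordIso[symmetric] bij_betw_def)
  define k where "k = inv_into UNIV e"
  have k_e: "k (e x) = x" for x
    using e by (simp add: k_def)
  define C where "C = \<lparr>carrier = e ` carrier ?D, oper = \<lambda>f xs. e (oper ?D f (map k xs))\<rparr>"
  have map_k: "map k xs \<in> tuples n (carrier ?D)" if "xs \<in> tuples n (carrier C)" for n xs
    using that by (auto simp: tuples_def C_def k_e subset_iff)
  have C: "universal_algebra U C"
    using D(1) map_k by (auto simp: universal_algebra_def C_def)
  have "bij_betw e (carrier ?D) (carrier C)"
    using inj_on_subset[OF e] by (simp add: C_def bij_betw_def)
  moreover have "e \<in> alg_hom U ?D C"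
    by (simp add: alg_hom_def C_def k_e comp_def)
  ultimately have e_iso: "e \<in> alg_iso U ?D C"
    by (simp add: alg_iso_def)
  have "bij_betw k (carrier C) (carrier ?D)"
    by (rule bij_betw_byWitness[where f' = e]) (auto simp: C_def k_e)
  moreover have "k \<in> alg_hom U C ?D"
    by (auto simp: alg_hom_def C_def k_e)
  ultimately have k_iso: "k \<in> alg_iso U C ?D"
    by (simp add: alg_iso_def)
  have "(\<lambda>x. snd (k x)) \<in> alg_hom U C Q"
  proof (rule alg_hom_compose[where C = ?D and g = k and h = snd])
    show "k \<in> alg_hom U C ?D" using k_iso by (simp add: alg_iso_def)
    show "snd \<in> alg_hom U ?D Q" by (auto simp: alg_hom_def twisted_product_def)
  qed
  \<comment> \<open>Each fibre is nonempty because it contains a pair with kernel component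
    0.\<close>
  moreover have "(\<lambda>x. snd (k x)) ` carrier C = carrier Q"
    using zero_closed by (auto simp: C_def k_e twisted_product_def image_image)
  ultimately have "extension U C (\<lambda>x. snd (k x)) Q"
    using C universal_algebra_base by (simp add: extension_def)
  moreover have "in_variety U C"
    using in_variety_iso[OF D(2) e_iso C assms(2)] .
  ultimately have "represented_by U C (\<lambda>x. snd (k x)) Q E T"
    using k_iso datum T by (auto simp: represented_by_def)
  then show ?thesis by blast
qed

text \<open>Conjugation with the two representing isomorphisms. They lie over \<open>\<pi>\<close>
  and \<open>\<rho>\<close>, so the condition on the base is carried along in both
  directions.\<close>

lemma lift_iff_hom_twisted_product:
  fixes U :: "'f variety"
  assumes "represented_by U A \<pi> Q B T" "represented_by U C \<rho> P E S"
  shows "(\<exists>\<gamma>'\<in>alg_hom U A C. \<forall>a\<in>carrier A. \<gamma> (\<pi> a) = \<rho> (\<gamma>' a)) \<longleftrightarrow>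
    (\<exists>k\<in>alg_hom U (twisted_product B T Q) (twisted_product E S P).
       \<forall>x\<in>carrier (twisted_product B T Q). snd (k x) = \<gamma> (snd x))" (is "?L \<longleftrightarrow> ?R")
proof -
  let ?TB = "twisted_product B T Q" and ?TE = "twisted_product E S P"
  obtain \<alpha> where \<alpha>: "\<alpha> \<in> alg_iso U A ?TB" and over_\<alpha>: "\<And>a. a \<in> carrier A \<Longrightarrow> snd (\<alpha> a) = \<pi> a"
    using assms(1) by (auto simp: represented_by_def)
  obtain \<beta> where \<beta>: "\<beta> \<in> alg_iso U C ?TE" and over_\<beta>: "\<And>c. c \<in> carrier C \<Longrightarrow> snd (\<beta> c) = \<rho> c"
    using assms(2) by (auto simp: represented_by_def)
  have A: "universal_algebra U A" and C: "universal_algebra U C"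
    using assms by (auto simp: represented_by_def in_variety_def)
  define \<alpha>' \<beta>' where "\<alpha>' = inv_into (carrier A) \<alpha>" and "\<beta>' = inv_into (carrier C) \<beta>"
  have hom: "\<alpha> \<in> alg_hom U A ?TB" "\<beta> \<in> alg_hom U C ?TE" "\<alpha>' \<in> alg_hom U ?TB A" "\<beta>' \<in> alg_hom U ?TE C"
    using \<alpha> \<beta> alg_iso_inverse[OF \<alpha> A] alg_iso_inverse[OF \<beta> C] by (auto simp: alg_iso_def \<alpha>'_def \<beta>'_def)
  have inv: "\<alpha> (\<alpha>' x) = x" if "x \<in> carrier ?TB" for x
    using that \<alpha> by (auto simp: alg_iso_def bij_betw_def \<alpha>'_def f_inv_into_f)
  have inv': "\<beta> (\<beta>' x) = x" if "x \<in> carrier ?TE" for x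
    using that \<beta> by (auto simp: alg_iso_def bij_betw_def \<beta>'_def f_inv_into_f)
  show ?thesis
  proof
    assume ?L
    then obtain g where g: "g \<in> alg_hom U A C" "\<And>a. a \<in> carrier A \<Longrightarrow> \<gamma> (\<pi> a) = \<rho> (g a)" by blast
    have "(\<lambda>x. \<beta> (g (\<alpha>' x))) \<in> alg_hom U ?TB ?TE"
      by (intro alg_hom_compose[OF _ hom(2)] alg_hom_compose[OF hom(3) g(1)])
    moreover have "snd (\<beta> (g (\<alpha>' x))) = \<gamma> (snd x)" if "x \<in> carrier ?TB" for x
    proof -
      have "\<alpha>' x \<in> carrier A" using alg_homD(1)[OF hom(3) that] .
      then show ?thesis
        using over_\<beta> over_\<alpha> g(2) inv[OF that] alg_homD(1)[OF g(1)] by metis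
    qed
    ultimately show ?R by (intro bexI[where x = "\<lambda>x. \<beta> (g (\<alpha>' x))"]) auto
  next
    assume ?R
    then obtain k where k: "k \<in> alg_hom U ?TB ?TE" "\<And>x. x \<in> carrier ?TB \<Longrightarrow> snd (k x) = \<gamma> (snd x)" by blast
    have "(\<lambda>a. \<beta>' (k (\<alpha> a))) \<in> alg_hom U A C"
      by (intro alg_hom_compose[OF _ hom(4)] alg_hom_compose[OF hom(1) k(1)])
    moreover have "\<gamma> (\<pi> a) = \<rho> (\<beta>' (k (\<alpha> a)))" if "a \<in> carrier A" for a
    proof -
      have "\<alpha> a \<in> carrier ?TB" using alg_homD(1)[OF hom(1) that] .
      moreover from this have "k (\<alpha> a) \<in> carrier ?TE" using alg_homD(1)[OF k(1)] by blast
      ultimately show ?thesis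
        using over_\<beta> over_\<alpha>[OF that] k(2) inv' alg_homD(1)[OF hom(4)] by metis
    qed
    ultimately show ?L by (intro bexI[where x = "\<lambda>a. \<beta>' (k (\<alpha> a))"]) auto
  qed
qed

text \<open>The common core of both converse directions, which choose \<open>\<gamma>\<close>
  differently: one takes it from representativity, the other takes the identity.\<close>

lemma transgression_if_lift:
  fixes U :: "'f variety" and Q :: "('f, 'u) alg"
  assumes dt: "has_difference_term TYPE('u) U"
    and A: "represented_by U A \<pi> Q B T" and C: "represented_by U C \<rho> P E S"
    and "central_datum U Q E" and \<gamma>: "\<gamma> \<in> alg_hom U Q P" and lift: "lifting_property U A \<pi> Q C \<rho> P"
  shows "\<exists>\<phi>\<in>carrier (kernel_Hom U B E).
    transgression U Q E T \<phi> = cohomology_class U Q E (cochain U Q (\<lambda>f qs. S f (map \<gamma> qs)))"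
proof -
  have "\<exists>\<gamma>'\<in>alg_hom U A C. \<forall>a\<in>carrier A. \<gamma> (\<pi> a) = \<rho> (\<gamma>' a)"
    using lift \<gamma> by (simp add: lifting_property_def)
  then obtain k where "k \<in> alg_hom U (twisted_product B T Q) (twisted_product E S P)"
    "\<And>x. x \<in> carrier (twisted_product B T Q) \<Longrightarrow> snd (k x) = \<gamma> (snd x)"
    unfolding lift_iff_hom_twisted_product[OF A C] by blast
  then show ?thesis
    using A C assms(4) \<gamma>
    by (intro transgression_if_hom_twisted_product[OF dt]) (auto simp: represented_by_def)
qed

section \<open>Lifting properties and surjectivity of the transgression\<close>

theorem proposition5p9:
  fixes U :: "'f variety"
    and Q A :: "('f, 'u) alg"
    and B :: "('f, 'r, 'u) kernel_alg"
    and E :: "('f, 's, 'u) kernel_alg"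
    and \<pi> :: "'u \<Rightarrow> 'u"
    and T :: "'f \<Rightarrow> 'u list \<Rightarrow> 'u"
  assumes "adequate_universe TYPE('f) TYPE('u)"
    and "wf_variety U"
    and "has_difference_term TYPE('u) U"
    and "central_datum U Q B"
    and "represented_by U A \<pi> Q B T"
    and "kernel_algebra U E" and "in_variety U (kalg E)"
  shows
    "(transgression_surjective U Q B E T \<longrightarrow>
        (\<forall>(C :: ('f, 'u) alg) \<rho> (P :: ('f, 'u) alg).
           realizes U C \<rho> P E \<longrightarrow> lifting_property U A \<pi> Q C \<rho> P))
     \<and>
     (\<forall>(F :: ('f, 'u) alg) (X :: 'x set) \<iota> \<theta>.
        free_presentation U F X \<iota> \<theta> Q \<longrightarrow>
        (\<exists>u. idempotent_elem U (quotient_alg F (commutator U F \<theta> (one_cong F))) u) \<longrightarrow>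
        (\<exists>(C :: ('f, 'u) alg) \<rho> S.
           representative U Q E C \<rho> Q S \<and> lifting_property U A \<pi> Q C \<rho> Q) \<longrightarrow>
        transgression_surjective U Q B E T)
     \<and>
     (\<forall>(F :: ('f, 'u) alg) (X :: 'x set) \<iota> \<theta>.
        free_presentation U F X \<iota> \<theta> Q \<longrightarrow>
        (\<exists>u. idempotent_elem U (quotient_alg F (commutator U F \<theta> (one_cong F))) u) \<longrightarrow>
        central_lifting_property U A \<pi> Q \<longrightarrow>
        (\<forall>E' :: ('f, 's, 'u) kernel_alg.
           kernel_algebra U E' \<longrightarrow> in_variety U (kalg E') \<longrightarrow>
           transgression_surjective U Q B E' T))"
proof -
  have m: "arity U (dsym U) = 3"
    using assms(3) by (simp add: has_difference_term_def)
  have T: "T \<in> carrier (cocycle_group U Q B)"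
    using assms(5) by (simp add: represented_by_def)
  \<comment> \<open>Stated for every \<open>E'\<close>, since the last claim lets the kernel algebra
    vary.\<close>
  have datum: "central_datum U Q E'" if "kernel_algebra U E'" "in_variety U (kalg E')"
    for E' :: "('f, 's, 'u) kernel_alg"
    using that assms(4) by (simp add: central_datum_def)
  note QE = datum[OF assms(6,7)]
  have part1: "lifting_property U A \<pi> Q C \<rho> P"
    if surj: "transgression_surjective U Q B E T" and C: "realizes U C \<rho> P E" for C P :: "('f, 'u) alg" and \<rho>
    unfolding lifting_property_def
  proof
    fix \<gamma> assume \<gamma>: "\<gamma> \<in> alg_hom U Q P"
    obtain S where C: "represented_by U C \<rho> P E S"
      using C by (auto simp: realizes_def)
    then have PE: "central_datum U P E" and S: "S \<in> carrier (cocycle_group U P E)"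
      by (simp_all add: represented_by_def)
    \<comment> \<open>The class pulled back along \<open>\<gamma>\<close> belongs to the cohomology
      of \<open>Q\<close>, so surjectivity provides a preimage \<open>\<phi>\<close>, and
      \<open>\<phi>\<close> yields the lift of \<open>\<gamma>\<close>.\<close>
    have "cohomology_class U Q E (cochain U Q (\<lambda>f qs. S f (map \<gamma> qs)))
        \<in> transgression U Q E T ` carrier (kernel_Hom U B E)"
      using surj pull_back_in_cocycle_group[OF QE PE S \<gamma>] central_data.carrier_H2[OF central_data.intro[OF QE]]
      by (simp add: transgression_surjective_def)
    then obtain \<phi> where \<phi>: "\<phi> \<in> carrier (kernel_Hom U B E)"
      "transgression U Q E T \<phi> = cohomology_class U Q E (cochain U Q (\<lambda>f qs. S f (map \<gamma> qs)))"
      by auto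
    show "\<exists>\<gamma>'\<in>alg_hom U A C. \<forall>a\<in>carrier A. \<gamma> (\<pi> a) = \<rho> (\<gamma>' a)"
      unfolding lift_iff_hom_twisted_product[OF assms(5) C]
      by (rule hom_twisted_product_if_transgression[OF assms(4) QE PE m T S \<gamma> \<phi>])
  qed
  have part2: "transgression_surjective U Q B E T"
    if rep: "representative U Q E C \<rho> Q S" and lift: "lifting_property U A \<pi> Q C \<rho> Q"
    for C :: "('f, 'u) alg" and \<rho> S
  proof (rule transgression_surjectiveI[OF assms(4) QE m T])
    fix R assume "R \<in> carrier (cocycle_group U Q E)"
    \<comment> \<open>Representativity turns the class of \<open>R\<close> into a pullback of
      \<open>S\<close> along \<open>\<gamma>\<close>; lifting this \<open>\<gamma>\<close> shows
      that the class is a transgression.\<close>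
    then obtain \<gamma> where "\<gamma> \<in> alg_hom U Q Q"
      "cohomology_class U Q E R = cohomology_class U Q E (cochain U Q (\<lambda>f qs. S f (map \<gamma> qs)))"
      using rep by (auto simp: representative_def)
    then show "\<exists>\<phi>\<in>carrier (kernel_Hom U B E). transgression U Q E T \<phi> = cohomology_class U Q E R"
      using transgression_if_lift[OF assms(3,5) _ QE _ lift] rep by (simp add: representative_def)
  qed
  have part3: "transgression_surjective U Q B E' T"
    if lift: "central_lifting_property U A \<pi> Q" and "kernel_algebra U E'" "in_variety U (kalg E')"
    for E' :: "('f, 's, 'u) kernel_alg"
  proof (rule transgression_surjectiveI[OF assms(4) _ m T])
    show QE': "central_datum U Q E'" using datum that by blast
    interpret central_data U Q E' by (unfold_locales) (rule QE')
    fix R assume R: "R \<in> carrier (cocycle_group U Q E')"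
    \<comment> \<open>Each \<open>R\<close> is realized by its own extension over the same
      \<open>Q\<close>. It is central, so the lifting hypothesis applies to it.\<close>
    obtain C :: "('f, 'u) alg" and \<rho> where C: "represented_by U C \<rho> Q E' R"
      using represented_by_exists[OF _ assms(2) QE' R] assms(1) by (auto simp: adequate_universe_def)
    have "lifting_property U A \<pi> Q C \<rho> Q"
      using lift C represented_by_central[OF C] by (simp add: central_lifting_property_def represented_by_def)
    moreover have "(\<lambda>q. q) \<in> alg_hom U Q Q"
      by (auto simp: alg_hom_def)
    \<comment> \<open>Pulling back along the identity returns \<open>R\<close> itself, not merely a
      cohomologous cocycle, because \<open>R\<close> is already normalized off the tuples.\<close>
    moreover have "cochain U Q (\<lambda>f qs. R f (map (\<lambda>q. q) qs)) = R"
      using R cochain_two_cocycle by (simp add: cocycle_group_def)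
    ultimately show "\<exists>\<phi>\<in>carrier (kernel_Hom U B E'). transgression U Q E' T \<phi> = cohomology_class U Q E' R"
      using transgression_if_lift[OF assms(3,5) C QE'] by metis
  qed
  show ?thesis
    using part1 part2 part3 by blast
qed

end
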